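(* There is a deterministic algorithm which, given a bipartite discounted game on a graph with $n$ nodes, finds its vector of values in $n^{O(1)}\cdot 2^n$ time and $n^{O(1)}$ space. The algorithm can be performed even when the discount factor and the edge weights are arbitrary real numbers (assuming basic arithmetic operations with them are carried out by an oracle).
   Context: A discounted game is given by a finite directed graph $G=(V,E)$ in which every node has at least one outgoing edge, a partition $V=V_{\mathrm{Max}}\sqcup V_{\mathrm{Min}}$, a weight function $w\colon E\to\mathbb{R}$ and a discount factor $\lambda\in(0,1)$. It is bipartite if $E\subseteq (V_{\mathrm{Max}}\times V_{\mathrm{Min}})\cup(V_{\mathrm{Min}}\times V_{\mathrm{Max}})$. The optimality equations for the game are, for $x\in\mathbb{R}^V$: $x_a=\max_{e=(a,b)\in E}\,(w(e)+\lambda x_b)$ for $a\in V_{\mathrm{Max}}$ and $x_a=\min_{e=(a,b)\in E}\,(w(e)+\lambda x_b)$ for $a\in V_{\mathrm{Min}}$. These equations have a unique solution $x^*$, called the vector of values; "finding the values" means computing $x^*$. *)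

theory Defs
  imports
    "HOL-Analysis.Analysis"
    "HOL-Library.Landau_Symbols"
    "HOL-Library.Log_Nat"
    "Graph_Theory.Pair_Digraph"
begin

section \<open>Discounted games\<close>

record 'v game =
  graph :: "'v pair_pre_digraph"
  max_nodes :: "'v set"
  min_nodes :: "'v set"
  weight :: "'v \<times> 'v \<Rightarrow> real"
  discount :: real

abbreviation nodes :: "'v game \<Rightarrow> 'v set" where
  "nodes \<Gamma> \<equiv> pverts (graph \<Gamma>)"

abbreviation edges :: "'v game \<Rightarrow> 'v rel" where
  "edges \<Gamma> \<equiv> parcs (graph \<Gamma>)"

definition discounted_game :: "'v game \<Rightarrow> bool" where
  "discounted_game \<Gamma> \<longleftrightarrow>
     pair_fin_digraph (graph \<Gamma>) \<and>
     (\<forall>a \<in> nodes \<Gamma>. \<exists>b. (a, b) \<in> edges \<Gamma>) \<and>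
     max_nodes \<Gamma> \<union> min_nodes \<Gamma> = nodes \<Gamma> \<and>
     max_nodes \<Gamma> \<inter> min_nodes \<Gamma> = {} \<and>
     0 < discount \<Gamma> \<and> discount \<Gamma> < 1"

definition bipartite :: "'v game \<Rightarrow> bool" where
  "bipartite \<Gamma> \<longleftrightarrow>
     edges \<Gamma> \<subseteq> (max_nodes \<Gamma> \<times> min_nodes \<Gamma>) \<union> (min_nodes \<Gamma> \<times> max_nodes \<Gamma>)"

definition optimality_equations :: "'v game \<Rightarrow> ('v \<Rightarrow> real) \<Rightarrow> bool" where
  "optimality_equations \<Gamma> x \<longleftrightarrow>
     (\<forall>a \<in> max_nodes \<Gamma>. x a = Max {weight \<Gamma> (a, b) + discount \<Gamma> * x b | b. (a, b) \<in> edges \<Gamma>}) \<and>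
     (\<forall>a \<in> min_nodes \<Gamma>. x a = Min {weight \<Gamma> (a, b) + discount \<Gamma> * x b | b. (a, b) \<in> edges \<Gamma>})"

text \<open>Vectors indexed by the nodes are functions that are \<^const>\<open>undefined\<close> off the node set.
  The description is proper by the lemma \<open>ex1_optimality_equations\<close> below.\<close>

definition game_values :: "'v game \<Rightarrow> 'v \<Rightarrow> real" where
  "game_values \<Gamma> = (THE x. x \<in> extensional (nodes \<Gamma>) \<and> optimality_equations \<Gamma> x)"

subsection \<open>Existence and uniqueness of the values\<close>

lemma Max_image_dist:
  fixes f g :: "'a \<Rightarrow> real"
  assumes fin: "finite A" and ne: "A \<noteq> {}" and le: "\<And>b. b \<in> A \<Longrightarrow> \<bar>f b - g b\<bar> \<le> e"
  shows "\<bar>Max (f ` A) - Max (g ` A)\<bar> \<le> e"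
proof -
  have *: "Max (h ` A) \<le> Max (k ` A) + e" if "\<And>b. b \<in> A \<Longrightarrow> \<bar>h b - k b\<bar> \<le> e" for h k :: "'a \<Rightarrow> real"
  proof -
    have "Max (h ` A) \<in> h ` A" using fin ne by (intro Max_in) auto
    then obtain b where b: "b \<in> A" "Max (h ` A) = h b" by auto
    have "k b \<le> Max (k ` A)" using fin b by auto
    then show ?thesis using that[OF b(1)] b(2) by linarith
  qed
  show ?thesis using *[of f g] *[of g f] le by (fastforce simp: abs_minus_commute abs_le_iff)
qed

lemma Min_image_dist:
  fixes f g :: "'a \<Rightarrow> real"
  assumes fin: "finite A" and ne: "A \<noteq> {}" and le: "\<And>b. b \<in> A \<Longrightarrow> \<bar>f b - g b\<bar> \<le> e"
  shows "\<bar>Min (f ` A) - Min (g ` A)\<bar> \<le> e"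
proof -
  have *: "Min (h ` A) - e \<le> Min (k ` A)" if "\<And>b. b \<in> A \<Longrightarrow> \<bar>h b - k b\<bar> \<le> e" for h k :: "'a \<Rightarrow> real"
  proof -
    have "Min (k ` A) \<in> k ` A" using fin ne by (intro Min_in) auto
    then obtain b where b: "b \<in> A" "Min (k ` A) = k b" by auto
    have "Min (h ` A) \<le> h b" using fin b by auto
    then show ?thesis using that[OF b(1)] b(2) by linarith
  qed
  show ?thesis using *[of f g] *[of g f] le by (fastforce simp: abs_minus_commute abs_le_iff)
qed

definition optimality_operator :: "'v game \<Rightarrow> ('v \<Rightarrow> real) \<Rightarrow> 'v \<Rightarrow> real" where
  "optimality_operator \<Gamma> x a =
     (if a \<in> max_nodes \<Gamma>
      then Max ((\<lambda>b. weight \<Gamma> (a, b) + discount \<Gamma> * x b) ` (edges \<Gamma> `` {a}))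
      else Min ((\<lambda>b. weight \<Gamma> (a, b) + discount \<Gamma> * x b) ` (edges \<Gamma> `` {a})))"

lemma optimality_equations_iff:
  assumes "discounted_game \<Gamma>"
  shows "optimality_equations \<Gamma> x \<longleftrightarrow> (\<forall>a \<in> nodes \<Gamma>. x a = optimality_operator \<Gamma> x a)"
proof -
  have "{weight \<Gamma> (a, b) + discount \<Gamma> * x b | b. (a, b) \<in> edges \<Gamma>}
      = (\<lambda>b. weight \<Gamma> (a, b) + discount \<Gamma> * x b) ` (edges \<Gamma> `` {a})" for a
    by auto
  moreover have "nodes \<Gamma> = max_nodes \<Gamma> \<union> min_nodes \<Gamma>" "max_nodes \<Gamma> \<inter> min_nodes \<Gamma> = {}"
    using assms by (auto simp: discounted_game_def)
  ultimately show ?thesis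
    unfolding optimality_equations_def optimality_operator_def by (auto simp: disjoint_iff)
qed

lemma optimality_operator_contraction:
  assumes game: "discounted_game \<Gamma>" and a: "a \<in> nodes \<Gamma>"
    and le: "\<And>b. b \<in> nodes \<Gamma> \<Longrightarrow> \<bar>x b - y b\<bar> \<le> e"
  shows "\<bar>optimality_operator \<Gamma> x a - optimality_operator \<Gamma> y a\<bar> \<le> discount \<Gamma> * e"
proof -
  interpret pair_fin_digraph "graph \<Gamma>" using game by (simp add: discounted_game_def)
  let ?A = "edges \<Gamma> `` {a}"
  have sub: "?A \<subseteq> nodes \<Gamma>" by (auto dest: in_arcsD2)
  then have fin: "finite ?A" using finite_subset pair_finite_verts by blast
  have ne: "?A \<noteq> {}" using game a by (auto simp: discounted_game_def)
  have "\<bar>(weight \<Gamma> (a, b) + discount \<Gamma> * x b) - (weight \<Gamma> (a, b) + discount \<Gamma> * y b)\<bar>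
      \<le> discount \<Gamma> * e" if "b \<in> ?A" for b
  proof -
    have "\<bar>discount \<Gamma> * (x b - y b)\<bar> \<le> discount \<Gamma> * e"
      using le[of b] that sub game by (auto simp: abs_mult discounted_game_def)
    then show ?thesis by (simp add: algebra_simps)
  qed
  then show ?thesis
    unfolding optimality_operator_def using Max_image_dist[OF fin ne] Min_image_dist[OF fin ne] by simp
qed

lemma optimality_equations_unique:
  assumes game: "discounted_game \<Gamma>"
    and x: "optimality_equations \<Gamma> x" and y: "optimality_equations \<Gamma> y" and a: "a \<in> nodes \<Gamma>"
  shows "x a = y a"
proof -
  interpret pair_fin_digraph "graph \<Gamma>" using game by (simp add: discounted_game_def)
  define D where "D = Max ((\<lambda>b. \<bar>x b - y b\<bar>) ` nodes \<Gamma>)"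
  have D: "\<bar>x b - y b\<bar> \<le> D" if "b \<in> nodes \<Gamma>" for b
    unfolding D_def using that by (intro Max_ge) auto
  have "D \<in> (\<lambda>b. \<bar>x b - y b\<bar>) ` nodes \<Gamma>"
    unfolding D_def using a by (intro Max_in) auto
  then obtain b where b: "b \<in> nodes \<Gamma>" "D = \<bar>x b - y b\<bar>" by auto
  have "x b = optimality_operator \<Gamma> x b" "y b = optimality_operator \<Gamma> y b"
    using x y b(1) optimality_equations_iff[OF game] by blast+
  then have "D \<le> discount \<Gamma> * D"
    using optimality_operator_contraction[OF game b(1) D] b(2) by simp
  then have "(1 - discount \<Gamma>) * D \<le> 0" by (simp add: algebra_simps)
  moreover have "0 < 1 - discount \<Gamma>" using game by (simp add: discounted_game_def)
  ultimately have "D \<le> 0" by (simp add: mult_le_0_iff)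
  then show ?thesis using D[OF a] by simp
qed

lemma optimality_equations_exist:
  assumes game: "discounted_game \<Gamma>"
  shows "\<exists>x. optimality_equations \<Gamma> x"
proof -
  interpret pair_fin_digraph "graph \<Gamma>" using game by (simp add: discounted_game_def)
  let ?F = "optimality_operator \<Gamma>" and ?d = "discount \<Gamma>"
  have d: "0 < ?d" "?d < 1" using game by (auto simp: discounted_game_def)
  define X where "X k = (?F ^^ k) (\<lambda>_. 0)" for k
  have X_Suc: "X (Suc k) = ?F (X k)" for k by (simp add: X_def)
  define D where "D = Max ((\<lambda>a. \<bar>X 1 a - X 0 a\<bar>) ` nodes \<Gamma>)"
  have step: "\<forall>a \<in> nodes \<Gamma>. \<bar>X (Suc k) a - X k a\<bar> \<le> D * ?d ^ k" for k
  proof (induction k)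
    case 0
    have "\<bar>X 1 a - X 0 a\<bar> \<le> D" if "a \<in> nodes \<Gamma>" for a
      unfolding D_def using that by (intro Max_ge) auto
    then show ?case by simp
  next
    case (Suc k)
    show ?case
    proof
      fix a assume a: "a \<in> nodes \<Gamma>"
      have "\<bar>?F (X (Suc k)) a - ?F (X k) a\<bar> \<le> ?d * (D * ?d ^ k)"
        using optimality_operator_contraction[OF game a] Suc by blast
      then show "\<bar>X (Suc (Suc k)) a - X (Suc k) a\<bar> \<le> D * ?d ^ Suc k"
        by (simp add: X_Suc mult.left_commute)
    qed
  qed
  have "convergent (\<lambda>k. X k a)" if a: "a \<in> nodes \<Gamma>" for a
  proof -
    have "summable (\<lambda>k. D * ?d ^ k)" using d by (intro summable_mult summable_geometric) auto
    then have "summable (\<lambda>k. X (Suc k) a - X k a)"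
      by (rule summable_comparison_test') (use step a in auto)
    then have "convergent (\<lambda>n. \<Sum>k<n. X (Suc k) a - X k a)" by (simp add: summable_iff_convergent)
    moreover have "(\<Sum>k<n. X (Suc k) a - X k a) = X n a" for n
      by (subst sum_lessThan_telescope) (simp add: X_def)
    ultimately show ?thesis by simp
  qed
  then obtain L where L: "\<And>a. a \<in> nodes \<Gamma> \<Longrightarrow> (\<lambda>k. X k a) \<longlonglongrightarrow> L a"
    unfolding convergent_def by metis
  have "L a = ?F L a" if a: "a \<in> nodes \<Gamma>" for a
  proof (rule LIMSEQ_unique)
    show "(\<lambda>k. X (Suc k) a) \<longlonglongrightarrow> L a" using L[OF a] by (rule LIMSEQ_Suc)
    show "(\<lambda>k. X (Suc k) a) \<longlonglongrightarrow> ?F L a"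
    proof (rule tendstoI)
      fix e :: real assume e: "0 < e"
      have "\<forall>\<^sub>F k in sequentially. \<forall>b \<in> nodes \<Gamma>. dist (X k b) (L b) < e"
        using L e by (intro eventually_ball_finite) (auto intro: tendstoD)
      then show "\<forall>\<^sub>F k in sequentially. dist (X (Suc k) a) (?F L a) < e"
      proof eventually_elim
        case (elim k)
        then have "\<bar>?F (X k) a - ?F L a\<bar> \<le> ?d * e"
          by (intro optimality_operator_contraction[OF game a]) (auto simp: dist_real_def less_imp_le)
        also have "\<dots> < e" using d e by simp
        finally show ?case by (simp add: X_Suc dist_real_def)
      qed
    qed
  qed
  then show ?thesis using optimality_equations_iff[OF game] by blast
qed

lemma ex1_optimality_equations:
  assumes game: "discounted_game \<Gamma>"
  shows "\<exists>!x. x \<in> extensional (nodes \<Gamma>) \<and> optimality_equations \<Gamma> x"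
proof -
  obtain x where x: "optimality_equations \<Gamma> x" using optimality_equations_exist[OF game] by blast
  have "optimality_operator \<Gamma> (restrict x (nodes \<Gamma>)) a = optimality_operator \<Gamma> x a"
    if "a \<in> nodes \<Gamma>" for a
    using optimality_operator_contraction[OF game that, of "restrict x (nodes \<Gamma>)" x 0] by simp
  then have "optimality_equations \<Gamma> (restrict x (nodes \<Gamma>))"
    using x unfolding optimality_equations_iff[OF game] by simp
  then show ?thesis
    using optimality_equations_unique[OF game]
    by (intro ex1I[of _ "restrict x (nodes \<Gamma>)"]) (auto intro: extensionalityI)
qed

lemma game_values_optimality_equations:
  "discounted_game \<Gamma> \<Longrightarrow> optimality_equations \<Gamma> (game_values \<Gamma>)"
  unfolding game_values_def by (drule ex1_optimality_equations, drule theI') blast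

section \<open>Algorithms with real arithmetic\<close>

text \<open>
  Algorithms are deterministic imperative programs over finitely many named arrays of naturals
  and of reals (a real random access machine). The reals are opaque: a program may apply the four
  field operations to them and compare them, each at unit cost, and it has only the constants
  0 and 1. There is no rounding and no conversion from reals to naturals. Division by zero
  yields 0.
\<close>

datatype nexp =
    NConst nat
  | NRead string nexp
  | NAdd nexp nexp
  | NSub nexp nexp
  | NMul nexp nexp
  | NDiv nexp nexp
  | NMod nexp nexp

datatype rexp =
    RZero
  | ROne
  | RRead string nexp
  | RAdd rexp rexp
  | RSub rexp rexp
  | RMul rexp rexp
  | RDiv rexp rexp

datatype bexp =
    NLess nexp nexp
  | NEq nexp nexp
  | RLess rexp rexp
  | REq rexp rexp
  | BNot bexp
  | BAnd bexp bexp

datatype com =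
    Skip
  | NWrite string nexp nexp
  | RWrite string nexp rexp
  | Seq com com
  | Cond bexp com com
  | While bexp com

record state =
  nats :: "string \<Rightarrow> nat list"
  reals :: "string \<Rightarrow> real list"

text \<open>Arrays grow on demand: a write beyond the end fills the gap with zeros, so that an array
  is as long as the largest index written to. Reads beyond the end yield 0.\<close>

definition read :: "'a::zero list \<Rightarrow> nat \<Rightarrow> 'a" where
  "read xs i = (if i < length xs then xs ! i else 0)"

definition "write" :: "'a::zero list \<Rightarrow> nat \<Rightarrow> 'a \<Rightarrow> 'a list" where
  "write xs i v = (if i < length xs then xs[i := v] else xs @ replicate (i - length xs) 0 @ [v])"

primrec neval :: "nexp \<Rightarrow> state \<Rightarrow> nat" where
  "neval (NConst k) s = k"
| "neval (NRead A i) s = read (nats s A) (neval i s)"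
| "neval (NAdd d e) s = neval d s + neval e s"
| "neval (NSub d e) s = neval d s - neval e s"
| "neval (NMul d e) s = neval d s * neval e s"
| "neval (NDiv d e) s = neval d s div neval e s"
| "neval (NMod d e) s = neval d s mod neval e s"

primrec reval :: "rexp \<Rightarrow> state \<Rightarrow> real" where
  "reval RZero s = 0"
| "reval ROne s = 1"
| "reval (RRead A i) s = read (reals s A) (neval i s)"
| "reval (RAdd d e) s = reval d s + reval e s"
| "reval (RSub d e) s = reval d s - reval e s"
| "reval (RMul d e) s = reval d s * reval e s"
| "reval (RDiv d e) s = reval d s / reval e s"

primrec beval :: "bexp \<Rightarrow> state \<Rightarrow> bool" where
  "beval (NLess d e) s \<longleftrightarrow> neval d s < neval e s"
| "beval (NEq d e) s \<longleftrightarrow> neval d s = neval e s"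
| "beval (RLess d e) s \<longleftrightarrow> reval d s < reval e s"
| "beval (REq d e) s \<longleftrightarrow> reval d s = reval e s"
| "beval (BNot b) s \<longleftrightarrow> \<not> beval b s"
| "beval (BAnd b c) s \<longleftrightarrow> beval b s \<and> beval c s"

primrec ncost :: "nexp \<Rightarrow> nat" where
  "ncost (NConst k) = 1"
| "ncost (NRead A i) = 1 + ncost i"
| "ncost (NAdd d e) = 1 + ncost d + ncost e"
| "ncost (NSub d e) = 1 + ncost d + ncost e"
| "ncost (NMul d e) = 1 + ncost d + ncost e"
| "ncost (NDiv d e) = 1 + ncost d + ncost e"
| "ncost (NMod d e) = 1 + ncost d + ncost e"

primrec rcost :: "rexp \<Rightarrow> nat" where
  "rcost RZero = 1"
| "rcost ROne = 1"
| "rcost (RRead A i) = 1 + ncost i"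
| "rcost (RAdd d e) = 1 + rcost d + rcost e"
| "rcost (RSub d e) = 1 + rcost d + rcost e"
| "rcost (RMul d e) = 1 + rcost d + rcost e"
| "rcost (RDiv d e) = 1 + rcost d + rcost e"

primrec bcost :: "bexp \<Rightarrow> nat" where
  "bcost (NLess d e) = 1 + ncost d + ncost e"
| "bcost (NEq d e) = 1 + ncost d + ncost e"
| "bcost (RLess d e) = 1 + rcost d + rcost e"
| "bcost (REq d e) = 1 + rcost d + rcost e"
| "bcost (BNot b) = 1 + bcost b"
| "bcost (BAnd b c) = 1 + bcost b + bcost c"

text \<open>A natural number occupies its number of binary digits and one more unit, a real number
  occupies one unit. Counting digits excludes storing large amounts of data in one natural
  number, and it makes unit cost for the arithmetic of naturals adequate: within polynomial
  space these operations act on numbers with polynomially many digits.\<close>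

definition space_of :: "state \<Rightarrow> nat" where
  "space_of s =
     (\<Sum>A | nats s A \<noteq> []. \<Sum>k\<leftarrow>nats s A. 1 + floorlog 2 k) +
     (\<Sum>A | reals s A \<noteq> []. length (reals s A))"

text \<open>\<open>exec c s t m s'\<close>: started in \<open>s\<close>, the program \<open>c\<close> halts in \<open>s'\<close> after \<open>t\<close> steps,
  and \<open>m\<close> is the maximal space of all states passed through, \<open>s\<close> and \<open>s'\<close> included.\<close>

inductive exec :: "com \<Rightarrow> state \<Rightarrow> nat \<Rightarrow> nat \<Rightarrow> state \<Rightarrow> bool" where
  Skip: "exec Skip s 1 (space_of s) s"
| NWrite:
    "s' = s\<lparr>nats := (nats s)(A := write (nats s A) (neval i s) (neval e s))\<rparr> \<Longrightarrow>
     exec (NWrite A i e) s (1 + ncost i + ncost e) (max (space_of s) (space_of s')) s'"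
| RWrite:
    "s' = s\<lparr>reals := (reals s)(A := write (reals s A) (neval i s) (reval e s))\<rparr> \<Longrightarrow>
     exec (RWrite A i e) s (1 + ncost i + rcost e) (max (space_of s) (space_of s')) s'"
| Seq:
    "exec c s t m s' \<Longrightarrow> exec c' s' t' m' s'' \<Longrightarrow>
     exec (Seq c c') s (t + t') (max m m') s''"
| CondTrue:
    "beval b s \<Longrightarrow> exec c s t m s' \<Longrightarrow> exec (Cond b c c') s (1 + bcost b + t) m s'"
| CondFalse:
    "\<not> beval b s \<Longrightarrow> exec c' s t m s' \<Longrightarrow> exec (Cond b c c') s (1 + bcost b + t) m s'"
| WhileFalse:
    "\<not> beval b s \<Longrightarrow> exec (While b c) s (1 + bcost b) (space_of s) s"
| WhileTrue:
    "beval b s \<Longrightarrow> exec c s t m s' \<Longrightarrow> exec (While b c) s' t' m' s'' \<Longrightarrow>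
     exec (While b c) s (1 + bcost b + t + t') (max m m') s''"

inductive_cases SkipE: "exec Skip s t m s'"
inductive_cases NWriteE: "exec (NWrite A i e) s t m s'"
inductive_cases RWriteE: "exec (RWrite A i e) s t m s'"
inductive_cases SeqE: "exec (Seq c c') s t m s'"
inductive_cases CondE: "exec (Cond b c c') s t m s'"
inductive_cases WhileE: "exec (While b c) s t m s'"

lemma exec_deterministic:
  "exec c s t m s' \<Longrightarrow> exec c s u l r \<Longrightarrow> u = t \<and> l = m \<and> r = s'"
proof (induction arbitrary: u l r rule: exec.induct)
  case Skip then show ?case by (auto elim: SkipE)
next
  case NWrite then show ?case by (auto elim: NWriteE)
next
  case RWrite then show ?case by (auto elim: RWriteE)
next
  case Seq from Seq.prems show ?case by (rule SeqE) (use Seq.IH in blast)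
next
  case CondTrue
  from CondTrue.prems CondTrue.hyps show ?case by (elim CondE) (simp_all add: CondTrue.IH)
next
  case CondFalse
  from CondFalse.prems CondFalse.hyps show ?case by (elim CondE) (simp_all add: CondFalse.IH)
next
  case WhileFalse
  from WhileFalse.prems show ?case by (rule WhileE) (simp_all add: WhileFalse.hyps)
next
  case (WhileTrue b s c t m s' t' m' s'')
  from WhileTrue.prems show ?case
  proof (rule WhileE)
    fix t1 m1 s1 t2 m2
    assume *: "u = Suc (bcost b + t1 + t2)" "l = max m1 m2"
      "exec c s t1 m1 s1" "exec (While b c) s1 t2 m2 r"
    have 1: "t1 = t" "m1 = m" "s1 = s'" using WhileTrue.IH(1)[OF *(3)] by simp_all
    have "t2 = t'" "m2 = m'" "r = s''" using WhileTrue.IH(2) *(4) unfolding 1 by simp_all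
    with * 1 show "u = 1 + bcost b + t + t' \<and> l = max m m' \<and> r = s''" by simp
  qed (use WhileTrue.hyps in simp)
qed

text \<open>By the following lemma the sums in \<^const>\<open>space_of\<close> are finite for all states that occur in a run on an
  encoded game.\<close>

lemma exec_finite_arrays:
  "exec c s t m s' \<Longrightarrow> finite {A. nats s A \<noteq> []} \<and> finite {A. reals s A \<noteq> []} \<Longrightarrow>
   finite {A. nats s' A \<noteq> []} \<and> finite {A. reals s' A \<noteq> []}"
proof (induction rule: exec.induct)
  case (NWrite s' s A i e)
  then have "{B. nats s' B \<noteq> []} \<subseteq> insert A {B. nats s B \<noteq> []}" by auto
  then have "finite {B. nats s' B \<noteq> []}" by (rule finite_subset) (use NWrite in simp)
  with NWrite show ?case by simp
next
  case (RWrite s' s A i e)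
  then have "{B. reals s' B \<noteq> []} \<subseteq> insert A {B. reals s B \<noteq> []}" by auto
  then have "finite {B. reals s' B \<noteq> []}" by (rule finite_subset) (use RWrite in simp)
  with RWrite show ?case by simp
qed simp_all

section \<open>Games as inputs\<close>

text \<open>The list \<open>vs\<close> numbers the nodes. The input consists of the number of nodes, the owners of
  the nodes (1 for Max, 0 for Min), the row-major adjacency matrix, the row-major matrix of edge
  weights (0 where there is no edge) and the discount factor.\<close>

definition encode :: "'v game \<Rightarrow> 'v list \<Rightarrow> state" where
  "encode \<Gamma> vs =
     \<lparr>nats = (\<lambda>_. [])
        (''size'' := [length vs],
         ''owner'' := map (\<lambda>a. if a \<in> max_nodes \<Gamma> then 1 else 0) vs,
         ''edge'' := map (\<lambda>e. if e \<in> edges \<Gamma> then 1 else 0) (List.product vs vs)),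
      reals = (\<lambda>_. [])
        (''weight'' := map (\<lambda>e. if e \<in> edges \<Gamma> then weight \<Gamma> e else 0) (List.product vs vs),
         ''discount'' := [discount \<Gamma>])\<rparr>"

definition finds_values :: "com \<Rightarrow> 'v game \<Rightarrow> 'v list \<Rightarrow> nat \<Rightarrow> nat \<Rightarrow> bool" where
  "finds_values P \<Gamma> vs t m \<longleftrightarrow>
     (\<exists>s. exec P (encode \<Gamma> vs) t m s \<and> reals s ''value'' = map (game_values \<Gamma>) vs)"

end

theory Submission
  imports Defs "HOL-Real_Asymp.Real_Asymp"
begin

text \<open>
  In a bipartite game negating the values of the nodes of Min turns the optimality equations into
  \<open>y\<^sub>a = max\<^sub>b (c\<^sub>a\<^sub>b - \<lambda> y\<^sub>b)\<close>, the same for all nodes. Relax them to \<open>y\<^sub>a \<ge> c\<^sub>a\<^sub>b - \<lambda> y\<^sub>b\<close> and call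
  an edge tight if equality holds; a feasible \<open>y\<close> is a solution iff every node has a tight edge.
  Otherwise play the following game on the tight edges: who cannot move loses, and a play of length
  \<open>i\<close> is worth \<open>\<lambda>\<^sup>i\<close>. The values \<open>d\<close> of this game satisfy \<open>d\<^sub>a = max (-1) (max\<^sub>b (-\<lambda> d\<^sub>b))\<close>, where \<open>b\<close>
  ranges over the tight edges. Replace \<open>y\<close> by \<open>y + \<epsilon> d\<close> with \<open>\<epsilon>\<close> as large as feasibility permits.
  The edges on which \<open>d\<close> is attained stay tight, and some new edge improving on \<open>d\<close> becomes tight.
  Let \<open>A\<^sub>i\<close> be the set of nodes from which optimal plays last exactly \<open>i\<close> moves. For the least \<open>i\<close> such
  that \<open>A\<^sub>i\<close> changes, \<open>A\<^sub>i\<close> shrinks if \<open>i\<close> is even and grows if \<open>i\<close> is odd. Hence the sequence of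
  cardinalities decreases in an alternating lexicographic order. As \<open>A\<^sub>i\<close> can be empty only if all later
  ones are, these sequences are compositions of numbers up to \<open>n\<close>; there are \<open>2\<^sup>n\<close> of them.
\<close>

section \<open>Ranking compositions in the alternating lexicographic order\<close>

text \<open>For a composition with parts \<open>r i - r (Suc i)\<close>, the number of its predecessors is
  \<open>\<Sum>i. (-1)\<^sup>i (2\<^bsup>r i\<^esup> - 2\<^bsup>r (i + 1)\<^esup>)\<close>.\<close>

fun alt_rank :: "(nat \<Rightarrow> nat) \<Rightarrow> nat \<Rightarrow> nat \<Rightarrow> int" where
  "alt_rank r 0 i = 0"
| "alt_rank r (Suc m) i = 2 ^ r i - 2 ^ r (Suc i) - alt_rank r m (Suc i)"

text \<open>\<open>r i\<close> is what remains after the first \<open>i\<close> parts of a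
  composition: it drops strictly until it stalls, and from then on it is constant.\<close>

definition gapless :: "(nat \<Rightarrow> nat) \<Rightarrow> bool" where
  "gapless r \<longleftrightarrow> (\<forall>i. r (Suc i) \<le> r i \<and> (r (Suc i) = r i \<longrightarrow> r (Suc (Suc i)) = r (Suc i)))"

lemma alt_rank_eq_0: "gapless r \<Longrightarrow> r (Suc i) = r i \<Longrightarrow> alt_rank r m i = 0"
  by (induction m arbitrary: i) (auto simp: gapless_def)

lemma two_pow_less: "a < b \<Longrightarrow> 2 * 2 ^ a \<le> (2::int) ^ b"
  using power_increasing[of "Suc a" b "2::int"] by simp

text \<open>If \<open>r (Suc i) < r i\<close>, then \<open>2 ^ r i\<close> is at least twice
  \<open>2 ^ r (Suc i)\<close>, so subtracting this power and a tail below it leaves something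
  nonnegative. Otherwise the composition has ended and the rank is 0.\<close>

lemma alt_rank_bounds:
  assumes "gapless r"
  shows "0 \<le> alt_rank r m i \<and> alt_rank r m i < 2 ^ r i"
proof (induction m arbitrary: i)
  case (Suc m)
  have IH: "0 \<le> alt_rank r m (Suc i)" "alt_rank r m (Suc i) < 2 ^ r (Suc i)" using Suc by auto
  show ?case
  proof (cases "r (Suc i) = r i")
    case True
    then show ?thesis using alt_rank_eq_0[OF assms, of i "Suc m"] by (metis less_irrefl order_refl zero_less_numeral zero_less_power)
  next
    case False
    then have "r (Suc i) < r i" using assms by (simp add: gapless_def le_neq_implies_less)
    then show ?thesis using IH two_pow_less[of "r (Suc i)" "r i"] by simp
  qed
qed auto

text \<open>At the first difference the tails are too small to outweigh the gap between the two
  powers, so the larger part wins there. Each earlier position contributes a minus sign, whence the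
  parity. \<open>i < m\<close> lets the truncated recursion reach the difference.\<close>

lemma alt_rank_less:
  assumes "gapless r" "gapless r'"
    and "\<And>j. j \<le> i \<Longrightarrow> r' (s + j) = r (s + j)" and "r (Suc (s + i)) < r' (Suc (s + i))" and "i < m"
  shows "if even i then alt_rank r' m s < alt_rank r m s else alt_rank r m s < alt_rank r' m s"
  using assms(3-)
proof (induction i arbitrary: s m)
  case 0
  then obtain m' where m: "m = Suc m'" by (cases m) auto
  show ?case
    using 0 two_pow_less[of "r (Suc s)" "r' (Suc s)"]
      alt_rank_bounds[OF assms(1), of m' "Suc s"] alt_rank_bounds[OF assms(2), of m' "Suc s"]
    by (simp add: m)
next
  case (Suc i)
  then obtain m' where m: "m = Suc m'" by (cases m) auto
  have "r' (Suc s + j) = r (Suc s + j)" if "j \<le> i" for j using Suc.prems(1)[of "Suc j"] that by simp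
  then have "if even i then alt_rank r' m' (Suc s) < alt_rank r m' (Suc s)
      else alt_rank r m' (Suc s) < alt_rank r' m' (Suc s)"
    using Suc.prems m by (intro Suc.IH) auto
  moreover have "r' s = r s" "r' (Suc s) = r (Suc s)" using Suc.prems(1)[of 0] Suc.prems(1)[of 1] by auto
  ultimately show ?case by (auto simp: m split: if_splits)
qed

section \<open>Discounted normal play\<close>

locale normal_play =
  fixes n :: nat and lam :: real
  assumes lam: "0 < lam" "lam < 1"
begin

text \<open>The term \<open>-1\<close> is the loss of a player who cannot move. It never exceeds the other terms, since all
  values lie between \<open>-1\<close> and \<open>1\<close>.\<close>

definition step :: "(nat \<Rightarrow> nat \<Rightarrow> bool) \<Rightarrow> (nat \<Rightarrow> real) \<Rightarrow> nat \<Rightarrow> real" where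
  "step T d a = Max (insert (- 1) ((\<lambda>b. - lam * d b) ` {b. b < n \<and> T a b}))"

lemma step_ge_minus1: "- 1 \<le> step T d a"
  and step_ge: "b < n \<Longrightarrow> T a b \<Longrightarrow> - lam * d b \<le> step T d a"
  and step_cases: "step T d a = - 1 \<or> (\<exists>b<n. T a b \<and> step T d a = - lam * d b)"
proof -
  let ?S = "insert (- 1) ((\<lambda>b. - lam * d b) ` {b. b < n \<and> T a b})"
  have fin: "finite ?S" by simp
  show "- 1 \<le> step T d a" unfolding step_def by (rule Max_ge[OF fin]) simp
  show "- lam * d b \<le> step T d a" if "b < n" "T a b"
    unfolding step_def by (rule Max_ge[OF fin]) (use that in auto)
  have "step T d a \<in> ?S" unfolding step_def by (rule Max_in[OF fin]) simp
  then show "step T d a = - 1 \<or> (\<exists>b<n. T a b \<and> step T d a = - lam * d b)" by auto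
qed

lemma step_eqI:
  assumes "- 1 \<le> v" and "\<And>b. b < n \<Longrightarrow> T a b \<Longrightarrow> - lam * d b \<le> v"
    and "v = - 1 \<or> (\<exists>b<n. T a b \<and> v = - lam * d b)"
  shows "v = step T d a"
  using assms step_ge_minus1[of T d a] step_ge[of _ T a d] step_cases[of T d a]
  by (metis order_antisym_conv)

lemma step_cong: "(\<And>b. b < n \<Longrightarrow> d b = d' b) \<Longrightarrow> step T d a = step T d' a"
  unfolding step_def by (metis (mono_tags, lifting) image_cong mem_Collect_eq)

text \<open>The worth of a play of \<open>i\<close> moves for the player who starts it: the
  \<open>-1\<close> of the stuck player, negated and discounted at each move. Even levels are
  losses, odd ones are wins, and the modulus falls with \<open>i\<close>.\<close>

definition level :: "nat \<Rightarrow> real" where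
  "level i = - ((- lam) ^ i)"

lemma level_0 [simp]: "level 0 = - 1"
  and level_Suc: "level (Suc i) = - lam * level i"
  and abs_level: "\<bar>level i\<bar> = lam ^ i"
  using lam by (auto simp: level_def power_abs)

lemma level_eq_iff [simp]: "level i = level j \<longleftrightarrow> i = j"
  using lam abs_level[of i] abs_level[of j] by (metis power_inject_exp' less_irrefl)

lemma level_nonzero [simp]: "level i \<noteq> 0"
  using lam by (simp add: level_def)

lemma pow_le_iff: "lam ^ i \<le> lam ^ j \<longleftrightarrow> j \<le> i"
  using lam by (simp add: power_decreasing_iff)

section \<open>Values of plays by iteration from zero\<close>

definition iter :: "(nat \<Rightarrow> nat \<Rightarrow> bool) \<Rightarrow> nat \<Rightarrow> nat \<Rightarrow> real" where
  "iter T k = (step T ^^ k) (\<lambda>_. 0)"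

lemma iter_0: "iter T 0 a = 0" and iter_Suc: "iter T (Suc k) a = step T (iter T k) a"
  by (simp_all add: iter_def)

lemma iter_values: "iter T k a = 0 \<or> (\<exists>i<k. iter T k a = level i)"
proof (induction k arbitrary: a)
  case (Suc k)
  from step_cases[of T "iter T k" a] show ?case
  proof
    assume "step T (iter T k) a = - 1"
    then show ?thesis by (auto simp: iter_Suc intro: exI[of _ 0])
  next
    assume "\<exists>b<n. T a b \<and> step T (iter T k) a = - lam * iter T k b"
    then obtain b where "iter T (Suc k) a = - lam * iter T k b" by (auto simp: iter_Suc)
    with Suc[of b] show ?thesis using level_Suc by (metis Suc_less_eq mult_zero_right)
  qed
qed (simp add: iter_0)

text \<open>In round \<open>k\<close> exactly the nodes whose plays last \<open>k\<close> moves leave the value \<open>0\<close>. Hence the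
  iteration is stationary after at most \<open>n\<close> rounds.\<close>

lemma iter_Suc_cases:
  "iter T (Suc k) a = iter T k a \<or> iter T k a = 0 \<and> iter T (Suc k) a = level k"
proof (induction k arbitrary: a)
  case 0
  from step_cases[of T "\<lambda>_. 0" a] show ?case by (auto simp: iter_def)
next
  case (Suc k)
  let ?m = "iter T (Suc k) a" and ?m' = "iter T (Suc (Suc k)) a"
  have IH: "iter T (Suc k) b = iter T k b \<or> iter T k b = 0 \<and> - lam * iter T (Suc k) b = level (Suc k)" for b
    using Suc[of b] by (auto simp: level_Suc)
  \<comment> \<open>By their moduli no level up to \<open>Suc k\<close> lies strictly between 0 and
    \<open>level (Suc k)\<close>. So a value pushed away from 0 in this round can only land on
    \<open>level (Suc k)\<close>.\<close>
  have lbig: "level i < \<bar>level (Suc k)\<bar> \<longrightarrow> level i < 0"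
    "i = Suc k \<or> 0 < level i \<or> level i < - \<bar>level (Suc k)\<bar>" if "i \<le> Suc k" for i
    using abs_level[of i] abs_level[of "Suc k"] pow_le_iff[of "i" "Suc k"] pow_le_iff[of "Suc k" "i"]
      level_nonzero[of i] that by linarith+
  have m: "?m = step T (iter T k) a" "?m' = step T (iter T (Suc k)) a" by (simp_all add: iter_Suc)
  show ?case
  proof (cases "0 < level (Suc k)")
    \<comment> \<open>By \<open>IH\<close> replies change only from 0 to
      \<open>level (Suc k)\<close>. So values can only rise in this case and only fall in the other
      one.\<close>
    case True
    have "?m' \<le> ?m \<or> ?m' = level (Suc k) \<and> 0 \<le> ?m"
      using step_cases[of T "iter T (Suc k)" a]
    proof (elim disjE exE conjE)
      fix b assume b: "b < n" "T a b" "step T (iter T (Suc k)) a = - lam * iter T (Suc k) b"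
      then show ?thesis using IH[of b] step_ge[of b T a "iter T k"] m by auto
    qed (use step_ge_minus1[of T "iter T k" a] m in auto)
    moreover have "?m \<le> ?m'"
      using step_cases[of T "iter T k" a]
    proof (elim disjE exE conjE)
      fix b assume b: "b < n" "T a b" "step T (iter T k) a = - lam * iter T k b"
      then show ?thesis using IH[of b] step_ge[of b T a "iter T (Suc k)"] True m by auto
    qed (use step_ge_minus1[of T "iter T (Suc k)" a] m in auto)
    moreover have "?m = 0 \<or> ?m < 0 \<or> level (Suc k) \<le> ?m"
      using iter_values[of T "Suc k" a] lbig(1) True by fastforce
    ultimately show ?thesis by linarith
  next
    case False
    then have neg: "level (Suc k) < 0" using level_nonzero[of "Suc k"] by linarith
    have "?m \<le> ?m' \<or> ?m = 0 \<and> level (Suc k) \<le> ?m'"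
      using step_cases[of T "iter T k" a]
    proof (elim disjE exE conjE)
      fix b assume b: "b < n" "T a b" "step T (iter T k) a = - lam * iter T k b"
      then show ?thesis using IH[of b] step_ge[of b T a "iter T (Suc k)"] m by auto
    qed (use step_ge_minus1[of T "iter T (Suc k)" a] m in auto)
    moreover have "?m' \<le> ?m"
      using step_cases[of T "iter T (Suc k)" a]
    proof (elim disjE exE conjE)
      fix b assume b: "b < n" "T a b" "step T (iter T (Suc k)) a = - lam * iter T (Suc k) b"
      then show ?thesis using IH[of b] step_ge[of b T a "iter T k"] neg m by auto
    qed (use step_ge_minus1[of T "iter T k" a] m in auto)
    moreover have "?m' = 0 \<or> 0 < ?m' \<or> ?m' < level (Suc k) \<or> ?m' = level (Suc k)"
      using iter_values[of T "Suc (Suc k)" a] lbig(2) neg by (auto simp: less_Suc_eq_le) fastforce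
    ultimately show ?thesis by linarith
  qed
qed

lemma iter_fixed:
  assumes "\<And>a. a < n \<Longrightarrow> iter T (Suc k) a = iter T k a" and "a < n"
  shows "iter T (k + m) a = iter T k a"
  using assms(2)
proof (induction m arbitrary: a)
  case (Suc m)
  have "iter T (k + Suc m) a = step T (iter T (k + m)) a" by (simp add: iter_Suc)
  also have "\<dots> = step T (iter T k) a" using Suc.IH by (intro step_cong) auto
  finally show ?case using assms(1)[OF Suc.prems] by (simp add: iter_Suc)
qed simp

definition val :: "(nat \<Rightarrow> nat \<Rightarrow> bool) \<Rightarrow> nat \<Rightarrow> real" where
  "val T = iter T n"

text \<open>By \<open>iter_Suc_cases\<close> a round that changes anything takes a node away from 0
  for good. So either some round up to \<open>n\<close> is stationary, or after \<open>n\<close>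
  rounds no node is left at 0 and nothing can change any more.\<close>

lemma val_fixpoint:
  assumes "a < n"
  shows "step T (val T) a = val T a"
proof -
  define Z where "Z k = {a. a < n \<and> iter T k a = 0}" for k
  have fin: "finite (Z k)" for k by (simp add: Z_def)
  have *: "(\<exists>j\<le>k. \<forall>a<n. iter T (Suc j) a = iter T j a) \<or> card (Z k) + k \<le> n" for k
  proof (induction k)
    case 0
    have "Z 0 = {..<n}" by (auto simp: Z_def iter_0)
    then show ?case by simp
  next
    case (Suc k)
    show ?case
    proof (cases "\<exists>j\<le>k. \<forall>a<n. iter T (Suc j) a = iter T j a")
      case True then show ?thesis by (meson le_SucI)
    next
      case False
      then obtain b where b: "b < n" "iter T (Suc k) b \<noteq> iter T k b" by blast
      have "b \<in> Z k" "b \<notin> Z (Suc k)" using b iter_Suc_cases[of T k b] by (auto simp: Z_def)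
      moreover have "Z (Suc k) \<subseteq> Z k"
        using iter_Suc_cases[of T k] by (auto simp: Z_def) (metis level_nonzero)
      ultimately have "card (Z (Suc k)) < card (Z k)" by (intro psubset_card_mono fin) auto
      then show ?thesis using Suc.IH False by auto
    qed
  qed
  have "iter T (Suc n) a = iter T n a"
  proof (cases "\<exists>j\<le>n. \<forall>a<n. iter T (Suc j) a = iter T j a")
    case True
    then obtain j where j: "j \<le> n" "\<And>a. a < n \<Longrightarrow> iter T (Suc j) a = iter T j a" by blast
    show ?thesis
      using iter_fixed[OF j(2) assms, of "n - j"] iter_fixed[OF j(2) assms, of "Suc n - j"] j(1) by simp
  next
    case False
    then have "Z n = {}" using *[of n] fin[of n] by auto
    then show ?thesis using assms iter_Suc_cases[of T n a] by (auto simp: Z_def)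
  qed
  then show ?thesis by (simp add: val_def iter_Suc)
qed

lemma val_values: "val T a = 0 \<or> (\<exists>i<n. val T a = level i)"
  using iter_values by (simp add: val_def)

lemma abs_val_le_1: "\<bar>val T a\<bar> \<le> 1"
  using val_values[of T a] abs_level lam by (auto intro!: power_le_one)

text \<open>The \<open>r\<close> of the composition whose parts count the nodes at level 0, 1, and
  so on. Nodes of value 0, from which optimal play never ends, are never removed.\<close>

definition rem :: "(nat \<Rightarrow> nat \<Rightarrow> bool) \<Rightarrow> nat \<Rightarrow> nat" where
  "rem T i = card {a. a < n \<and> (\<forall>j<i. val T a \<noteq> level j)}"

lemma rem_0: "rem T 0 = n"
proof -
  have "{a. a < n} = {..<n}" by auto
  then show ?thesis by (simp add: rem_def)
qed

lemma rem_Suc: "rem T i = rem T (Suc i) + card {a. a < n \<and> val T a = level i}"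
proof -
  let ?A = "{a. a < n \<and> val T a = level i}"
  let ?B = "{a. a < n \<and> (\<forall>j<Suc i. val T a \<noteq> level j)}"
  have "{a. a < n \<and> (\<forall>j<i. val T a \<noteq> level j)} = ?B \<union> ?A"
    by (auto simp: less_Suc_eq)
  moreover have "card (?B \<union> ?A) = card ?B + card ?A"
    by (rule card_Un_disjoint) auto
  ultimately show ?thesis by (simp add: rem_def)
qed

text \<open>An optimal move from a node of value \<open>level (Suc i)\<close> leads to one of value
  \<open>level i\<close>, so an empty level forces the next one to be empty.\<close>

lemma gapless_rem: "gapless (rem T)"
  unfolding gapless_def
proof (intro allI conjI impI)
  fix i
  show "rem T (Suc i) \<le> rem T i" using rem_Suc[of T i] by simp
  assume "rem T (Suc i) = rem T i"
  then have emp: "{a. a < n \<and> val T a = level i} = {}" using rem_Suc[of T i] by simp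
  have "val T a \<noteq> level (Suc i)" if "a < n" for a
  proof
    assume v: "val T a = level (Suc i)"
    have "val T a = level 0 \<or> (\<exists>b<n. val T a = - lam * val T b)"
      using val_fixpoint[OF that, of T] step_cases[of T "val T" a] by auto
    moreover have "val T a \<noteq> level 0" unfolding v level_eq_iff by simp
    ultimately obtain b where "b < n" "- lam * val T b = - lam * level i"
      using v level_Suc[of i] by auto
    then show False using emp lam by auto
  qed
  then show "rem T (Suc (Suc i)) = rem T (Suc i)" using rem_Suc[of T "Suc i"] by auto
qed

text \<open>Depth \<open>n\<close> suffices, since by \<open>val_values\<close> all levels that
  occur are below \<open>n\<close>.\<close>

definition rank :: "(nat \<Rightarrow> nat \<Rightarrow> bool) \<Rightarrow> nat" where
  "rank T = nat (alt_rank (rem T) n 0)"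

lemma rank_less: "rank T < 2 ^ n"
  using alt_rank_bounds[OF gapless_rem, of T n 0] by (simp add: rank_def rem_0 nat_less_iff)

text \<open>Below the first level \<open>i\<close> that changes, both value functions agree. The
  kept optimal moves let no new node enter level \<open>i\<close> if it is a loss (\<open>i\<close>
  even) and no old node leave it if it is a win (\<open>i\<close> odd). So an even part shrinks or
  an odd part grows, and either lowers the rank.\<close>

lemma rank_decreases:
  assumes keep: "\<And>a. a < n \<Longrightarrow> val T a \<noteq> - 1 \<Longrightarrow> \<exists>b<n. T' a b \<and> val T a = - lam * val T b"
    and new: "a0 < n" "b0 < n" "T' a0 b0" "val T a0 < - lam * val T b0"
  shows "rank T' < rank T"
proof -
  define A where "A T i = {a. a < n \<and> val T a = level i}" for T i
  have fin: "finite (A T i)" for T i by (simp add: A_def)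
  \<comment> \<open>If the values did not change, the fixed point equation for \<open>T'\<close>
    would contradict the new edge.\<close>
  have "\<exists>a<n. val T' a \<noteq> val T a"
    using step_ge[of b0 T' a0 "val T'"] val_fixpoint[of a0 T'] new by (metis not_less)
  then obtain a where a: "a < n" "val T' a \<noteq> val T a" by blast
  have ex: "\<exists>i<n. A T i \<noteq> A T' i"
  proof (cases "val T a = 0")
    case False
    then obtain i where i: "i < n" "val T a = level i" using val_values by blast
    then have "a \<in> A T i" "a \<notin> A T' i" using a by (auto simp: A_def)
    then show ?thesis using i by blast
  next
    case True
    then obtain i where i: "i < n" "val T' a = level i" using a val_values[of T' a] by auto
    then have "a \<notin> A T i" "a \<in> A T' i" using a by (auto simp: A_def)
    then show ?thesis using i by blast
  qed
  define i where "i = (LEAST i. A T i \<noteq> A T' i)"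
  have diff: "A T i \<noteq> A T' i" and "i < n"
    using ex LeastI[of "\<lambda>i. A T i \<noteq> A T' i"] Least_le[of "\<lambda>i. A T i \<noteq> A T' i"]
    unfolding i_def by (meson le_less_trans)+
  have same: "A T j = A T' j" if "j < i" for j using that not_less_Least unfolding i_def by blast
  have same_val: "val T a = level j \<longleftrightarrow> val T' a = level j" if "j < i" "a < n" for a j
    using same[OF that(1)] that(2) by (auto simp: A_def)
  have eq: "rem T' j = rem T j" if "j \<le> i" for j
    using that
  proof (induction j)
    case (Suc j)
    then show ?case using rem_Suc[of T j] rem_Suc[of T' j] same[of j] by (simp add: A_def)
  qed (simp add: rem_0)
  have bounds: "0 \<le> alt_rank (rem T) n 0" "0 \<le> alt_rank (rem T') n 0"
    using alt_rank_bounds[OF gapless_rem] by auto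
  show ?thesis
  proof (cases "even i")
    case True
    \<comment> \<open>Under \<open>T'\<close> the kept move to \<open>b\<close> must lead to a win
      for the opponent, at a level \<open>j\<close> with \<open>Suc j <= i\<close>. Level
      \<open>j\<close> has not changed, so under \<open>T\<close> the node \<open>a\<close> has
      \<open>level (Suc j)\<close>; and \<open>Suc j < i\<close> would contradict the agreement at
      level \<open>Suc j\<close>.\<close>
    have "A T' i \<subseteq> A T i"
    proof
      fix a assume "a \<in> A T' i"
      then have a: "a < n" and v': "val T' a = level i" by (auto simp: A_def)
      have neg: "level i < 0" using True lam by (simp add: level_def)
      show "a \<in> A T i"
      proof (cases "val T a = - 1")
        case m1: True
        then have "i = 0" using same_val[OF _ a, of 0] v' by (metis level_0 level_eq_iff neq0_conv)
        then show ?thesis using a m1 by (simp add: A_def)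
      next
        case False
        then obtain b where b: "b < n" "T' a b" "val T a = - lam * val T b" using keep[OF a] by blast
        have le: "- lam * val T' b \<le> level i"
          using step_ge[of b T' a "val T'"] val_fixpoint[OF a, of T'] b v' by simp
        then have "0 < val T' b" using neg lam by (smt (verit) mult_minus_left mult_nonneg_nonpos)
        then obtain j where j: "val T' b = level j" using val_values[of T' b] by auto
        have "lam ^ Suc j \<ge> lam ^ i"
          using le abs_level[of i] abs_level[of j] neg \<open>0 < val T' b\<close> j by simp
        then have "Suc j \<le> i" by (simp only: pow_le_iff)
        then have "val T b = level j" using same_val[of j b] b j by simp
        then have "val T a = level (Suc j)" using b by (simp add: level_Suc)
        then have "Suc j = i" using same_val[of "Suc j" a] a v' \<open>Suc j \<le> i\<close> by (cases "Suc j = i") auto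
        then show ?thesis using \<open>val T a = level (Suc j)\<close> a by (simp add: A_def)
      qed
    qed
    then have "card (A T' i) < card (A T i)" using diff by (intro psubset_card_mono fin) auto
    then have "rem T (Suc i) < rem T' (Suc i)"
      using rem_Suc[of T i] rem_Suc[of T' i] eq[of i] by (simp add: A_def)
    then show ?thesis
      using alt_rank_less[OF gapless_rem gapless_rem, of i T' 0 T n] eq True \<open>i < n\<close> bounds
      by (simp add: rank_def)
  next
    case False
    then obtain l where l: "i = Suc l" by (cases i) auto
    \<comment> \<open>The kept move leads to the unchanged level \<open>l\<close> and secures at
      least \<open>level i\<close> under \<open>T'\<close>. A strictly better value would be a win
      at a lower level, where nothing has changed.\<close>
    have "A T i \<subseteq> A T' i"
    proof
      fix a assume "a \<in> A T i"
      then have a: "a < n" and v: "val T a = level i" by (auto simp: A_def)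
      have pos: "0 < level i" using False lam by (simp add: level_def)
      then obtain b where b: "b < n" "T' a b" "val T a = - lam * val T b" using keep[OF a] v by force
      then have "val T b = level l" using v l lam by (simp add: level_Suc)
      then have "val T' b = level l" using same_val[of l b] b l by simp
      then have ge: "level i \<le> val T' a"
        using step_ge[of b T' a "val T'"] val_fixpoint[OF a, of T'] b l by (simp add: level_Suc)
      then obtain j where j: "val T' a = level j" using val_values[of T' a] pos by auto
      have "lam ^ i \<le> lam ^ j" using ge pos abs_level[of i] abs_level[of j] j by simp
      then have "j \<le> i" by (simp only: pow_le_iff)
      then have "j = i" using same_val[of j a] a v j by (cases "j = i") auto
      then show "a \<in> A T' i" using j a by (simp add: A_def)
    qed
    then have "card (A T i) < card (A T' i)" using diff by (intro psubset_card_mono fin) auto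
    then have "rem T' (Suc i) < rem T (Suc i)"
      using rem_Suc[of T i] rem_Suc[of T' i] eq[of i] by (simp add: A_def)
    then show ?thesis
      using alt_rank_less[OF gapless_rem gapless_rem, of i T 0 T' n] eq False \<open>i < n\<close> bounds
      by (simp add: rank_def)
  qed
qed

end

section \<open>Moving inside the relaxed optimality equations\<close>

locale negamax = normal_play +
  fixes E :: "nat \<Rightarrow> nat \<Rightarrow> bool" and c :: "nat \<Rightarrow> nat \<Rightarrow> real"
  assumes total: "a < n \<Longrightarrow> \<exists>b<n. E a b"
begin

definition feasible :: "(nat \<Rightarrow> real) \<Rightarrow> bool" where
  "feasible y \<longleftrightarrow> (\<forall>a<n. \<forall>b<n. E a b \<longrightarrow> c a b \<le> y a + lam * y b)"

definition tight :: "(nat \<Rightarrow> real) \<Rightarrow> nat \<Rightarrow> nat \<Rightarrow> bool" where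
  "tight y a b \<longleftrightarrow> E a b \<and> y a + lam * y b = c a b"

text \<open>The inverse of the step length up to which the edge stays feasible. On a tight edge it is \<open>0\<close> by
  \<open>x / 0 = 0\<close>, and tight edges indeed never limit the step. In the same way the step length \<open>1 / q\<close>
  becomes \<open>0\<close> if no edge limits the step.\<close>

definition ratio :: "(nat \<Rightarrow> real) \<Rightarrow> (nat \<Rightarrow> real) \<Rightarrow> nat \<Rightarrow> nat \<Rightarrow> real" where
  "ratio y d a b = (- lam * d b - d a) / (y a + lam * y b - c a b)"

definition inverse_step_length :: "(nat \<Rightarrow> real) \<Rightarrow> (nat \<Rightarrow> real) \<Rightarrow> real \<Rightarrow> bool" where
  "inverse_step_length y d q \<longleftrightarrow>
     0 \<le> q \<and> (\<forall>a<n. \<forall>b<n. E a b \<longrightarrow> ratio y d a b \<le> q) \<and>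
     (q = 0 \<or> (\<exists>a<n. \<exists>b<n. E a b \<and> q = ratio y d a b))"

text \<open>The slack of an edge changes by \<open>(d a + lam * d b) / q\<close>. On tight edges
  this is nonnegative because \<open>val\<close> is a fixed point of \<open>step\<close>; on the
  others \<open>ratio y d a b \<le> q\<close> says that the slack is not overdrawn.\<close>

lemma feasible_move:
  assumes f: "feasible y" and d: "\<And>a. a < n \<Longrightarrow> d a = val (tight y) a"
    and q: "inverse_step_length y d q" and y': "\<And>a. a < n \<Longrightarrow> y' a = y a + d a / q"
  shows "feasible y'"
  unfolding feasible_def
proof (intro allI impI)
  fix a b assume ab: "a < n" "b < n" "E a b"
  have slack: "c a b \<le> y a + lam * y b" using f ab by (simp add: feasible_def)
  have r: "ratio y d a b \<le> q" "0 \<le> q" using q ab by (auto simp: inverse_step_length_def)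
  have *: "y' a + lam * y' b - c a b = (y a + lam * y b - c a b) + (d a + lam * d b) / q"
    using ab by (simp add: y' field_simps add_divide_distrib)
  show "c a b \<le> y' a + lam * y' b"
  proof (cases "y a + lam * y b = c a b \<or> q = 0")
    case False
    then have pos: "0 < y a + lam * y b - c a b" "0 < q" using slack r by auto
    then have "- (d a + lam * d b) \<le> q * (y a + lam * y b - c a b)"
      using r(1) by (simp add: ratio_def divide_le_eq)
    then have "- (d a + lam * d b) / q \<le> y a + lam * y b - c a b"
      using pos by (simp add: divide_le_eq mult.commute)
    moreover have "- (d a + lam * d b) / q = - ((d a + lam * d b) / q)" by (rule minus_divide_left[symmetric])
    ultimately show ?thesis using * by linarith
  next
    case True
    then show ?thesis
    proof
      assume "y a + lam * y b = c a b"
      then have "- lam * d b \<le> d a"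
        using step_ge[of b "tight y" a "val (tight y)"] ab val_fixpoint[of a "tight y"] d
        by (simp add: tight_def)
      then have "0 \<le> (d a + lam * d b) / q" using r(2) by simp
      then show ?thesis using * slack by linarith
    qed (use * slack in simp)
  qed
qed

text \<open>Edges on which \<open>d\<close> is attained have \<open>d a + lam * d b = 0\<close> and
  stay tight, while the edge that realises \<open>q\<close> becomes tight and offers a better reply.
  This is what \<open>rank_decreases\<close> asks for.\<close>

lemma rank_move:
  assumes f: "feasible y" and d: "\<And>a. a < n \<Longrightarrow> d a = val (tight y) a"
    and q: "inverse_step_length y d q" and y': "\<And>a. a < n \<Longrightarrow> y' a = y a + d a / q"
    and "0 < q"
  shows "rank (tight y') < rank (tight y)"
proof -
  have *: "y' a + lam * y' b = (y a + lam * y b) + (d a + lam * d b) / q" if "a < n" "b < n" for a b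
    using that by (simp add: y' field_simps add_divide_distrib)
  obtain a0 b0 where e: "a0 < n" "b0 < n" "E a0 b0" "q = ratio y d a0 b0"
    using q \<open>0 < q\<close> by (auto simp: inverse_step_length_def)
  have s: "0 \<le> y a0 + lam * y b0 - c a0 b0" using f e by (simp add: feasible_def)
  have q_eq: "q = (- lam * d b0 - d a0) / (y a0 + lam * y b0 - c a0 b0)"
    using e(4) by (simp add: ratio_def)
  \<comment> \<open>Slack zero would give \<open>q = 0\<close> by \<open>x / 0 = 0\<close>.\<close>
  with s \<open>0 < q\<close> have s: "0 < y a0 + lam * y b0 - c a0 b0" by (cases "y a0 + lam * y b0 - c a0 b0 = 0") auto
  have num: "- lam * d b0 - d a0 = q * (y a0 + lam * y b0 - c a0 b0)" using q_eq s by simp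
  then have "(d a0 + lam * d b0) / q = - (y a0 + lam * y b0 - c a0 b0)"
    using \<open>0 < q\<close> by (simp add: field_simps)
  then have t: "tight y' a0 b0" using *[OF e(1,2)] e(3) by (simp add: tight_def)
  have "0 < q * (y a0 + lam * y b0 - c a0 b0)" using s \<open>0 < q\<close> by simp
  then have less: "d a0 < - lam * d b0" using num by linarith
  show ?thesis
  proof (rule rank_decreases[of "tight y" "tight y'", OF _ e(1,2) t])
    show "val (tight y) a0 < - lam * val (tight y) b0" using less d e by simp
    fix a assume a: "a < n" "val (tight y) a \<noteq> - 1"
    then obtain b where b: "b < n" "tight y a b" "val (tight y) a = - lam * val (tight y) b"
      using step_cases[of "tight y" "val (tight y)" a] val_fixpoint[of a "tight y"] by auto
    then have "d a + lam * d b = 0" using d a by simp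
    then have "tight y' a b" using *[OF a(1) b(1)] b(2) by (simp add: tight_def)
    then show "\<exists>b<n. tight y' a b \<and> val (tight y) a = - lam * val (tight y) b" using b by blast
  qed
qed

text \<open>A node without tight edges has \<open>d a = - 1\<close>, whereas every reply is worth at
  least \<open>- lam\<close>. As all its edges have positive slack, any of them would have a
  positive ratio.\<close>

lemma no_move_imp_tight:
  assumes f: "feasible y" and d: "\<And>a. a < n \<Longrightarrow> d a = val (tight y) a"
    and q: "inverse_step_length y d 0" and a: "a < n"
  shows "\<exists>b<n. tight y a b"
proof (rule ccontr)
  assume no: "\<not> (\<exists>b<n. tight y a b)"
  then have da: "d a = - 1"
    using step_cases[of "tight y" "val (tight y)" a] val_fixpoint[OF a, of "tight y"] d[OF a] by auto
  obtain b where b: "b < n" "E a b" using total[OF a] by blast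
  have "c a b \<le> y a + lam * y b" "y a + lam * y b \<noteq> c a b"
    using f no a b by (auto simp: feasible_def tight_def)
  then have s: "0 < y a + lam * y b - c a b" by simp
  have "lam * d b \<le> lam * 1"
    using d[OF b(1)] abs_val_le_1[of "tight y" b] lam by (intro mult_left_mono) auto
  then have "0 < - lam * d b - d a" using da lam by linarith
  then have "0 < ratio y d a b" using s by (simp add: ratio_def)
  moreover have "ratio y d a b \<le> 0" using q a b by (auto simp: inverse_step_length_def)
  ultimately show False by simp
qed

end

section \<open>Weakest preconditions with time and space bounds\<close>

text \<open>Bounding lengths and entries by one \<open>B\<close> reduces the space claim to a check
  of the index and the value at each write.\<close>

definition small :: "string set \<Rightarrow> nat \<Rightarrow> state \<Rightarrow> bool" where
  "small X B s \<longleftrightarrow>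
     (\<forall>A. A \<notin> X \<longrightarrow> nats s A = [] \<and> reals s A = []) \<and>
     (\<forall>A. length (nats s A) \<le> B \<and> length (reals s A) \<le> B \<and> (\<forall>k\<in>set (nats s A). k \<le> B))"

definition space_bound :: "string set \<Rightarrow> nat \<Rightarrow> nat" where
  "space_bound X B = card X * (B * (1 + B)) + card X * B"

lemma floorlog_le_self: "floorlog 2 k \<le> k"
proof (cases "k = 0")
  case False
  have "k < 2 ^ k" by (rule less_exp)
  then show ?thesis using floorlog_le_iff[of 2 k k] by simp
qed (simp add: floorlog_def)

lemma space_of_le:
  assumes "small X B s" and "finite X"
  shows "space_of s \<le> space_bound X B"
proof -
  have le: "(\<Sum>k\<leftarrow>nats s A. 1 + floorlog 2 k) \<le> B * (1 + B)" for A
  proof -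
    have "(\<Sum>k\<leftarrow>nats s A. 1 + floorlog 2 k) \<le> (\<Sum>k\<leftarrow>nats s A. 1 + B)"
    proof (rule sum_list_mono)
      fix k assume "k \<in> set (nats s A)"
      then have "k \<le> B" using assms(1) by (auto simp: small_def)
      then show "1 + floorlog 2 k \<le> 1 + B" using floorlog_le_self[of k] by simp
    qed
    also have "\<dots> = length (nats s A) * (1 + B)" by (simp add: sum_list_triv)
    also have "\<dots> \<le> B * (1 + B)" using assms(1) by (intro mult_right_mono) (auto simp: small_def)
    finally show ?thesis .
  qed
  have "(\<Sum>A | nats s A \<noteq> []. \<Sum>k\<leftarrow>nats s A. 1 + floorlog 2 k) \<le> (\<Sum>A | nats s A \<noteq> []. B * (1 + B))"
    by (rule sum_mono) (rule le)
  also have "\<dots> \<le> (\<Sum>A\<in>X. B * (1 + B))"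
    using assms by (intro sum_mono2) (auto simp: small_def)
  also have "\<dots> = card X * (B * (1 + B))" by simp
  finally have N: "(\<Sum>A | nats s A \<noteq> []. \<Sum>k\<leftarrow>nats s A. 1 + floorlog 2 k) \<le> card X * (B * (1 + B))" .
  have "(\<Sum>A | reals s A \<noteq> []. length (reals s A)) \<le> (\<Sum>A | reals s A \<noteq> []. B)"
    using assms by (intro sum_mono) (auto simp: small_def)
  also have "\<dots> \<le> (\<Sum>A\<in>X. B)"
    using assms by (intro sum_mono2) (auto simp: small_def)
  also have "\<dots> = card X * B" by simp
  finally show ?thesis using N by (simp add: space_of_def space_bound_def)
qed

lemma length_write: "length (write xs i v) = max (length xs) (Suc i)"
  by (auto simp: write_def)

lemma set_write: "set (write xs i v) \<subseteq> insert 0 (insert v (set xs))"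
  by (auto simp: write_def dest: subsetD[OF set_update_subset_insert] split: if_splits)

lemma read_write [simp]: "read (write xs i v) j = (if j = i then v else read xs j)"
  by (auto simp: read_def write_def nth_append)

lemma read_Nil [simp]: "read [] i = 0"
  and read_Cons_0 [simp]: "read (x # xs) 0 = x"
  by (simp_all add: read_def)

text \<open>One halting run suffices, since \<open>exec\<close> is deterministic.
  \<open>small\<close> is assumed at the start and returned at the end, so that along a program only
  the times have to be added up.\<close>

definition wp :: "string set \<Rightarrow> nat \<Rightarrow> nat \<Rightarrow> com \<Rightarrow> (state \<Rightarrow> bool) \<Rightarrow> state \<Rightarrow> bool" where
  "wp X B t c Q s \<longleftrightarrow>
     (small X B s \<longrightarrow> (\<exists>t' m s'. exec c s t' m s' \<and> t' \<le> t \<and> m \<le> space_bound X B \<and> small X B s' \<and> Q s'))"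

lemma wp_mono:
  "wp X B t c Q s \<Longrightarrow> t \<le> t' \<Longrightarrow> (\<And>s'. Q s' \<Longrightarrow> Q' s') \<Longrightarrow> wp X B t' c Q' s"
  unfolding wp_def by (meson order_trans)

lemma wp_Skip: "finite X \<Longrightarrow> Q s \<Longrightarrow> wp X B 1 Skip Q s"
  unfolding wp_def using exec.Skip space_of_le by blast

lemma wp_NWrite:
  assumes "finite X" "A \<in> X" "neval i s < B" "neval e s \<le> B"
    and "Q (s\<lparr>nats := (nats s)(A := write (nats s A) (neval i s) (neval e s))\<rparr>)"
  shows "wp X B (1 + ncost i + ncost e) (NWrite A i e) Q s"
  unfolding wp_def
proof
  let ?s = "s\<lparr>nats := (nats s)(A := write (nats s A) (neval i s) (neval e s))\<rparr>"
  assume s: "small X B s"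
  then have s': "small X B ?s"
    using assms set_write[of "nats s A" "neval i s" "neval e s"]
    by (auto simp: small_def length_write)
  have "exec (NWrite A i e) s (1 + ncost i + ncost e) (max (space_of s) (space_of ?s)) ?s"
    by (rule exec.NWrite) simp
  then show "\<exists>t' m s'. exec (NWrite A i e) s t' m s' \<and> t' \<le> 1 + ncost i + ncost e
      \<and> m \<le> space_bound X B \<and> small X B s' \<and> Q s'"
    using space_of_le[OF s assms(1)] space_of_le[OF s' assms(1)] s' assms(5)
    by (metis max.bounded_iff order_refl)
qed

lemma wp_RWrite:
  assumes "finite X" "A \<in> X" "neval i s < B"
    and "Q (s\<lparr>reals := (reals s)(A := write (reals s A) (neval i s) (reval e s))\<rparr>)"
  shows "wp X B (1 + ncost i + rcost e) (RWrite A i e) Q s"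
  unfolding wp_def
proof
  let ?s = "s\<lparr>reals := (reals s)(A := write (reals s A) (neval i s) (reval e s))\<rparr>"
  assume s: "small X B s"
  then have s': "small X B ?s" using assms by (auto simp: small_def length_write)
  have "exec (RWrite A i e) s (1 + ncost i + rcost e) (max (space_of s) (space_of ?s)) ?s"
    by (rule exec.RWrite) simp
  then show "\<exists>t' m s'. exec (RWrite A i e) s t' m s' \<and> t' \<le> 1 + ncost i + rcost e
      \<and> m \<le> space_bound X B \<and> small X B s' \<and> Q s'"
    using space_of_le[OF s assms(1)] space_of_le[OF s' assms(1)] s' assms(4)
    by (metis max.bounded_iff order_refl)
qed

lemma wp_Seq:
  assumes "wp X B t c (wp X B t' c' Q) s"
  shows "wp X B (t + t') (Seq c c') Q s"
  unfolding wp_def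
proof
  assume "small X B s"
  then obtain t1 m1 s1 where 1: "exec c s t1 m1 s1" "t1 \<le> t" "m1 \<le> space_bound X B" "small X B s1"
    "wp X B t' c' Q s1" using assms unfolding wp_def[of X B t c] by blast
  then obtain t2 m2 s2 where 2: "exec c' s1 t2 m2 s2" "t2 \<le> t'" "m2 \<le> space_bound X B" "small X B s2" "Q s2"
    unfolding wp_def by blast
  show "\<exists>t'' m s'. exec (Seq c c') s t'' m s' \<and> t'' \<le> t + t' \<and> m \<le> space_bound X B \<and> small X B s' \<and> Q s'"
    using exec.Seq[OF 1(1) 2(1)] 1 2 by (intro exI[of _ "t1 + t2"] exI[of _ "max m1 m2"] exI[of _ s2]) auto
qed

lemma wp_Cond:
  assumes "beval b s \<Longrightarrow> wp X B t c Q s" and "\<not> beval b s \<Longrightarrow> wp X B t c' Q s"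
  shows "wp X B (1 + bcost b + t) (Cond b c c') Q s"
proof (cases "beval b s")
  case True
  then show ?thesis using assms(1)[OF True] exec.CondTrue[OF True] unfolding wp_def
    by (meson add_le_cancel_left)
next
  case False
  then show ?thesis using assms(2)[OF False] exec.CondFalse[OF False] unfolding wp_def
    by (meson add_le_cancel_left)
qed

text \<open>The measure \<open>f\<close> bounds the number of passes; the summand outside the
  product pays for the last, failing test.\<close>

lemma wp_While:
  assumes "finite X"
    and body: "\<And>s. I s \<Longrightarrow> beval b s \<Longrightarrow> wp X B t c (\<lambda>s'. I s' \<and> f s' < f s) s"
    and I: "I s" and f: "f s \<le> N"
  shows "wp X B (N * (1 + bcost b + t) + (1 + bcost b)) (While b c) (\<lambda>s'. I s' \<and> \<not> beval b s') s"
  using I f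
proof (induction N arbitrary: s rule: less_induct)
  case (less N)
  show ?case unfolding wp_def
  proof
    assume s: "small X B s"
    show "\<exists>t' m s'. exec (While b c) s t' m s' \<and> t' \<le> N * (1 + bcost b + t) + (1 + bcost b) \<and>
       m \<le> space_bound X B \<and> small X B s' \<and> I s' \<and> \<not> beval b s'"
    proof (cases "beval b s")
      case False
      then show ?thesis using exec.WhileFalse[OF False, of c] space_of_le[OF s assms(1)] s less.prems
        by (metis le_add2)
    next
      case True
      then obtain t1 m1 s1 where 1: "exec c s t1 m1 s1" "t1 \<le> t" "m1 \<le> space_bound X B" "small X B s1"
        "I s1" "f s1 < f s" using body[OF less.prems(1)] s unfolding wp_def by blast
      then obtain N' where N: "N = Suc N'" using less.prems by (cases N) auto
      have "wp X B (N' * (1 + bcost b + t) + (1 + bcost b)) (While b c) (\<lambda>s'. I s' \<and> \<not> beval b s') s1"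
        using 1 less.prems N by (intro less.IH) auto
      then obtain t2 m2 s2 where 2: "exec (While b c) s1 t2 m2 s2"
        "t2 \<le> N' * (1 + bcost b + t) + (1 + bcost b)" "m2 \<le> space_bound X B" "small X B s2"
        "I s2" "\<not> beval b s2"
        using 1(4) unfolding wp_def by blast
      show ?thesis using exec.WhileTrue[OF True 1(1) 2(1)] 1 2
        by (intro exI[of _ "1 + bcost b + t1 + t2"] exI[of _ "max m1 m2"] exI[of _ s2]) (auto simp: N)
    qed
  qed
qed

section \<open>Counting loops\<close>

definition For :: "string \<Rightarrow> nexp \<Rightarrow> com \<Rightarrow> com" where
  "For v N c =
     Seq (NWrite v (NConst 0) (NConst 0))
       (While (NLess (NRead v (NConst 0)) N)
         (Seq c (NWrite v (NConst 0) (NAdd (NRead v (NConst 0)) (NConst 1)))))"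

text \<open>Writing cell 0 of an array of length at most 1 leaves a singleton, so the counter is
  known exactly. \<open>ctr\<close> ensures that \<open>Nx\<close>, evaluated anew in every pass,
  always yields \<open>N\<close>.\<close>

lemma wp_For:
  assumes X: "finite X" "v \<in> X" "N \<le> B" "0 < B" and v: "length (nats s v) \<le> 1"
    and I0: "I 0 (s\<lparr>nats := (nats s)(v := [0])\<rparr>)"
    and ctr: "\<And>k s. I k s \<Longrightarrow> nats s v = [k] \<and> neval Nx s = N"
    and body: "\<And>k s. k < N \<Longrightarrow> I k s \<Longrightarrow>
      wp X B t c (\<lambda>s'. nats s' v = [k] \<and> I (Suc k) (s'\<lparr>nats := (nats s')(v := [Suc k])\<rparr>)) s"
  shows "wp X B (N * (10 + ncost Nx + t) + (7 + ncost Nx)) (For v Nx c) (I N) s"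
proof -
  let ?I = "\<lambda>s. \<exists>k\<le>N. I k s"
  have w: "write xs 0 x = [x]" if "length xs \<le> 1" for xs :: "nat list" and x
    using that by (cases xs) (auto simp: write_def)
  have loop: "wp X B (N * (1 + bcost (NLess (NRead v (NConst 0)) Nx) + (t + 6))
      + (1 + bcost (NLess (NRead v (NConst 0)) Nx)))
      (While (NLess (NRead v (NConst 0)) Nx)
        (Seq c (NWrite v (NConst 0) (NAdd (NRead v (NConst 0)) (NConst 1)))))
      (\<lambda>s'. ?I s' \<and> \<not> beval (NLess (NRead v (NConst 0)) Nx) s') (s\<lparr>nats := (nats s)(v := [0])\<rparr>)"
  proof (rule wp_While[where f = "\<lambda>s. N - read (nats s v) 0"])
    fix s assume "?I s" and b: "beval (NLess (NRead v (NConst 0)) Nx) s"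
    then obtain k where k: "I k s" by blast
    then have kN: "k < N" using b ctr[OF k] by simp
    have "wp X B (t + (1 + ncost (NConst 0) + ncost (NAdd (NRead v (NConst 0)) (NConst 1))))
       (Seq c (NWrite v (NConst 0) (NAdd (NRead v (NConst 0)) (NConst 1))))
       (\<lambda>s'. ?I s' \<and> N - read (nats s' v) 0 < N - read (nats s v) 0) s"
    proof (rule wp_Seq, rule wp_mono[OF body[OF kN k] order_refl])
      fix s' assume s': "nats s' v = [k] \<and> I (Suc k) (s'\<lparr>nats := (nats s')(v := [Suc k])\<rparr>)"
      show "wp X B (1 + ncost (NConst 0) + ncost (NAdd (NRead v (NConst 0)) (NConst 1)))
         (NWrite v (NConst 0) (NAdd (NRead v (NConst 0)) (NConst 1)))
         (\<lambda>s'. ?I s' \<and> N - read (nats s' v) 0 < N - read (nats s v) 0) s'"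
        by (rule wp_NWrite) (use X kN s' ctr[OF k] in \<open>auto simp: w intro!: exI[of _ "Suc k"]\<close>)
    qed
    then show "wp X B (t + 6)
       (Seq c (NWrite v (NConst 0) (NAdd (NRead v (NConst 0)) (NConst 1))))
       (\<lambda>s'. ?I s' \<and> N - read (nats s' v) 0 < N - read (nats s v) 0) s"
      by (simp add: eval_nat_numeral)
  qed (use X I0 in auto)
  have "wp X B (1 + ncost (NConst 0) + ncost (NConst 0) + (N * (1 + bcost (NLess (NRead v (NConst 0)) Nx) + (t + 6))
      + (1 + bcost (NLess (NRead v (NConst 0)) Nx)))) (For v Nx c)
      (\<lambda>s'. ?I s' \<and> \<not> beval (NLess (NRead v (NConst 0)) Nx) s') s"
    unfolding For_def by (rule wp_Seq, rule wp_NWrite) (use X loop w[OF v] in auto)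
  then show ?thesis
  proof (rule wp_mono)
    fix s' assume "?I s' \<and> \<not> beval (NLess (NRead v (NConst 0)) Nx) s'"
    then obtain k where k: "k \<le> N" "I k s'" "\<not> beval (NLess (NRead v (NConst 0)) Nx) s'" by blast
    then have "k = N" using ctr[OF k(2)] by simp
    then show "I N s'" using k by simp
  qed (simp add: algebra_simps)
qed

text \<open>The states between the passes of \<open>For_Write\<close>: all but the counter and one
  real array is as before. Frame conditions then hold by simplification, and loop invariants speak
  only of the list \<open>xs\<close>.\<close>

definition upd :: "state \<Rightarrow> string \<Rightarrow> nat \<Rightarrow> string \<Rightarrow> real list \<Rightarrow> state" where
  "upd s v k A xs = s\<lparr>nats := (nats s)(v := [k]), reals := (reals s)(A := xs)\<rparr>"

lemma nats_upd [simp]: "nats (upd s v k A xs) = (nats s)(v := [k])"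
  and reals_upd [simp]: "reals (upd s v k A xs) = (reals s)(A := xs)"
  by (simp_all add: upd_def)

definition For_Write :: "string \<Rightarrow> nexp \<Rightarrow> bexp \<Rightarrow> string \<Rightarrow> nexp \<Rightarrow> rexp \<Rightarrow> com" where
  "For_Write v N b A i e = For v N (Cond b (RWrite A i e) Skip)"

lemma wp_For_Write:
  assumes X: "finite X" "v \<in> X" "A \<in> X" "N \<le> B" "0 < B" and v: "length (nats s v) \<le> 1"
    and N: "\<And>k xs. neval Nx (upd s v k A xs) = N"
    and J0: "J 0 (reals s A)"
    and yes: "\<And>k xs. k < N \<Longrightarrow> J k xs \<Longrightarrow> beval b (upd s v k A xs) \<Longrightarrow>
      neval i (upd s v k A xs) < B \<and>
      J (Suc k) (write xs (neval i (upd s v k A xs)) (reval e (upd s v k A xs)))"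
    and no: "\<And>k xs. k < N \<Longrightarrow> J k xs \<Longrightarrow> \<not> beval b (upd s v k A xs) \<Longrightarrow> J (Suc k) xs"
  shows "wp X B (N * (12 + ncost Nx + bcost b + ncost i + rcost e) + (7 + ncost Nx)) (For_Write v Nx b A i e)
    (\<lambda>s'. \<exists>xs. s' = upd s v N A xs \<and> J N xs) s"
proof -
  have "wp X B (N * (10 + ncost Nx + (1 + bcost b + (1 + ncost i + rcost e))) + (7 + ncost Nx))
    (For_Write v Nx b A i e) (\<lambda>s'. \<exists>xs. s' = upd s v N A xs \<and> J N xs) s"
    unfolding For_Write_def
  proof (rule wp_For[where I = "\<lambda>k s'. \<exists>xs. s' = upd s v k A xs \<and> J k xs"])
    show "\<exists>xs. s\<lparr>nats := (nats s)(v := [0])\<rparr> = upd s v 0 A xs \<and> J 0 xs"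
      using J0 by (intro exI[of _ "reals s A"]) (simp add: upd_def)
    show "nats s' v = [k] \<and> neval Nx s' = N" if "\<exists>xs. s' = upd s v k A xs \<and> J k xs" for k s'
      using that N by auto
    fix k s' assume k: "k < N" and "\<exists>xs. s' = upd s v k A xs \<and> J k xs"
    then obtain xs where s': "s' = upd s v k A xs" and J: "J k xs" by blast
    let ?Q = "\<lambda>s'. nats s' v = [k] \<and>
      (\<exists>xs. s'\<lparr>nats := (nats s')(v := [Suc k])\<rparr> = upd s v (Suc k) A xs \<and> J (Suc k) xs)"
    show "wp X B (1 + bcost b + (1 + ncost i + rcost e)) (Cond b (RWrite A i e) Skip) ?Q s'"
    proof (rule wp_Cond)
      assume b: "beval b s'"
      show "wp X B (1 + ncost i + rcost e) (RWrite A i e) ?Q s'"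
        using yes[OF k J] b X s'
        by (intro wp_RWrite) (auto simp: upd_def intro!: exI[of _ "write xs (neval i s') (reval e s')"])
    next
      assume b: "\<not> beval b s'"
      have "wp X B 1 Skip ?Q s'"
        using no[OF k J] b X s' by (intro wp_Skip) (auto simp: upd_def intro!: exI[of _ xs])
      then show "wp X B (1 + ncost i + rcost e) Skip ?Q s'" by (rule wp_mono) auto
    qed
  qed (use X v in auto)
  then show ?thesis by (rule wp_mono) auto
qed

definition true_exp :: bexp where
  "true_exp = NEq (NConst 0) (NConst 0)"

lemma true_exp_simps [simp]: "beval true_exp s" "bcost true_exp = 3"
  by (simp_all add: true_exp_def)

text \<open>When entry \<open>k\<close> is computed, its cell still holds the old value; assumption
  \<open>e\<close> may rely on this. It admits updates in place, such as that of
  \<open>y\<close>.\<close>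

lemma wp_For_Write_map:
  assumes X: "finite X" "v \<in> X" "A \<in> X" "N \<le> B" "0 < B" and v: "length (nats s v) \<le> 1"
    and N: "\<And>k xs. neval Nx (upd s v k A xs) = N"
    and e: "\<And>k xs. k < N \<Longrightarrow> read xs k = read (reals s A) k \<Longrightarrow> reval e (upd s v k A xs) = g k"
  shows "wp X B (N * (17 + ncost Nx + rcost e) + (7 + ncost Nx))
    (For_Write v Nx true_exp A (NRead v (NConst 0)) e)
    (\<lambda>s'. \<exists>xs. s' = upd s v N A xs \<and> (\<forall>k<N. read xs k = g k) \<and> length xs = max (length (reals s A)) N) s"
proof -
  have "wp X B (N * (12 + ncost Nx + bcost true_exp + ncost (NRead v (NConst 0)) + rcost e) + (7 + ncost Nx))
    (For_Write v Nx true_exp A (NRead v (NConst 0)) e)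
    (\<lambda>s'. \<exists>xs. s' = upd s v N A xs \<and> ((\<forall>k<N. read xs k = g k) \<and>
       (\<forall>k\<ge>N. read xs k = read (reals s A) k) \<and> length xs = max (length (reals s A)) N)) s"
    by (rule wp_For_Write) (use X v N e in \<open>auto simp: length_write less_Suc_eq\<close>)
  then show ?thesis by (rule wp_mono) auto
qed

section \<open>The program\<close>

definition names :: "string set" where
  "names = {''size'', ''owner'', ''edge'', ''weight'', ''discount'', ''i'', ''k'',
     ''bound'', ''sign'', ''y'', ''q'', ''dir'', ''next'', ''value''}"

lemma finite_names [simp]: "finite names" and card_names: "card names = 14"
  by (simp_all add: names_def)

lemma names_mem [simp]:
  "''i'' \<in> names" "''k'' \<in> names" "''bound'' \<in> names" "''sign'' \<in> names" "''y'' \<in> names"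
  "''q'' \<in> names" "''dir'' \<in> names" "''next'' \<in> names" "''value'' \<in> names"
  by (simp_all add: names_def)

abbreviation size_exp :: nexp where "size_exp \<equiv> NRead ''size'' (NConst 0)"
abbreviation idx_exp :: nexp where "idx_exp \<equiv> NRead ''i'' (NConst 0)"
abbreviation square_exp :: nexp where "square_exp \<equiv> NMul size_exp size_exp"
abbreviation row_exp :: nexp where "row_exp \<equiv> NDiv idx_exp size_exp"
abbreviation col_exp :: nexp where "col_exp \<equiv> NMod idx_exp size_exp"
abbreviation lam_exp :: rexp where "lam_exp \<equiv> RRead ''discount'' (NConst 0)"
abbreviation slack_exp :: rexp where
  "slack_exp \<equiv> RSub (RAdd (RRead ''y'' row_exp) (RMul lam_exp (RRead ''y'' col_exp)))
     (RMul (RRead ''sign'' row_exp) (RRead ''weight'' idx_exp))"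
abbreviation reply_exp :: rexp where
  "reply_exp \<equiv> RSub RZero (RMul lam_exp (RRead ''dir'' col_exp))"
abbreviation ratio_exp :: rexp where
  "ratio_exp \<equiv> RDiv (RSub reply_exp (RRead ''dir'' row_exp)) slack_exp"
abbreviation edge_exp :: bexp where
  "edge_exp \<equiv> NEq (NRead ''edge'' idx_exp) (NConst 1)"

text \<open>The initial point is the constant \<open>1 + \<Sum> w\<^sup>2\<close>, which bounds all \<open>\<bar>w\<bar>\<close>.\<close>

definition init_com :: com where
  "init_com =
     Seq (RWrite ''bound'' (NConst 0) ROne)
    (Seq (For_Write ''i'' square_exp true_exp ''bound'' (NConst 0)
           (RAdd (RRead ''bound'' (NConst 0)) (RMul (RRead ''weight'' idx_exp) (RRead ''weight'' idx_exp))))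
    (Seq (For_Write ''i'' size_exp true_exp ''sign'' idx_exp (RSub RZero ROne))
    (Seq (For_Write ''i'' size_exp (NEq (NRead ''owner'' idx_exp) (NConst 1)) ''sign'' idx_exp ROne)
    (Seq (For_Write ''i'' size_exp true_exp ''y'' idx_exp (RRead ''bound'' (NConst 0)))
         (RWrite ''q'' (NConst 0) ROne)))))"

text \<open>The new values are collected in \<open>next\<close>, since \<open>step\<close> needs all
  the old ones. They start at \<open>-1\<close>, the term for the loss.\<close>

definition round_com :: com where
  "round_com =
     Seq (For_Write ''i'' size_exp true_exp ''next'' idx_exp (RSub RZero ROne))
    (Seq (For_Write ''i'' square_exp
           (BAnd edge_exp (BAnd (REq slack_exp RZero) (RLess (RRead ''next'' row_exp) reply_exp)))
           ''next'' row_exp reply_exp)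
         (For_Write ''i'' size_exp true_exp ''dir'' idx_exp (RRead ''next'' idx_exp)))"

definition direction_com :: com where
  "direction_com = Seq (For_Write ''i'' size_exp true_exp ''dir'' idx_exp RZero) (For ''k'' size_exp round_com)"

definition move_com :: com where
  "move_com =
     Seq direction_com
    (Seq (RWrite ''q'' (NConst 0) RZero)
    (Seq (For_Write ''i'' square_exp (BAnd edge_exp (RLess (RRead ''q'' (NConst 0)) ratio_exp))
           ''q'' (NConst 0) ratio_exp)
         (For_Write ''i'' size_exp true_exp ''y'' idx_exp
           (RAdd (RRead ''y'' idx_exp) (RDiv (RRead ''dir'' idx_exp) (RRead ''q'' (NConst 0)))))))"

text \<open>\<open>q\<close> doubles as the loop guard: \<open>init_com\<close> sets it to 1 to
  enter the loop, and a move that finds 0 ends it. Multiplication by \<open>sign\<close> undoes the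
  negation at the nodes of Min.\<close>

definition solve_com :: com where
  "solve_com =
     Seq init_com
    (Seq (While (RLess RZero (RRead ''q'' (NConst 0))) move_com)
         (For_Write ''i'' size_exp true_exp ''value'' idx_exp (RMul (RRead ''sign'' idx_exp) (RRead ''y'' idx_exp))))"

text \<open>Fits the linear cost of a loop over the nodes under the quadratic
  \<open>loop_time\<close>.\<close>

lemma loop_bound:
  fixes n :: nat
  assumes "numeral k \<le> (numeral m :: nat)"
  shows "n * numeral k \<le> numeral a + numeral m * (n * n)"
proof -
  have "n * numeral k \<le> (n * n) * numeral m" by (rule mult_le_mono[OF le_square assms])
  then show ?thesis by (metis mult.commute trans_le_add2)
qed

section \<open>Row-major indices of pairs of nodes\<close>

lemma pair_index:
  fixes e n :: nat
  assumes "e < n * n"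
  shows "e div n < n" "e mod n < n" "e div n * n + e mod n = e"
proof -
  have "0 < n" using assms by (cases n) auto
  then show "e div n < n" "e mod n < n" "e div n * n + e mod n = e"
    using less_mult_imp_div_less[OF assms] by auto
qed

lemma pair_index_less:
  fixes a b n :: nat
  assumes "a < n" "b < n"
  shows "a * n + b < n * n"
proof -
  have "a * n + b < Suc a * n" using assms by simp
  also have "\<dots> \<le> n * n" using assms by (intro mult_right_mono) auto
  finally show ?thesis .
qed

section \<open>Correctness and running time of the program\<close>

text \<open>Negating the rows of Min turns its minima into maxima; the change of sign along each
  edge of a bipartite game accounts for the minus in \<open>c a b - lam * y b\<close>.\<close>

locale encoded_game = negamax n lam E c for n lam E c +
  fixes w :: "nat \<Rightarrow> real" and owner :: "nat \<Rightarrow> bool"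
  assumes c_eq: "c a b = (if owner a then 1 else - 1) * w (a * n + b)"
begin

text \<open>The bound exceeds all indices used and all naturals stored; the largest of these is
  \<open>n * n\<close>, where the counter over pairs stops.\<close>

abbreviation WP :: "nat \<Rightarrow> com \<Rightarrow> (state \<Rightarrow> bool) \<Rightarrow> state \<Rightarrow> bool" where
  "WP \<equiv> wp names (n * n + n + 1)"

definition env :: "state \<Rightarrow> bool" where
  "env s \<longleftrightarrow> nats s ''size'' = [n] \<and>
     (\<forall>a<n. read (nats s ''owner'') a = (if owner a then 1 else 0)) \<and>
     (\<forall>e<n * n. read (nats s ''edge'') e = (if E (e div n) (e mod n) then 1 else 0)) \<and>
     (\<forall>e<n * n. read (reals s ''weight'') e = w e) \<and>
     reals s ''discount'' = [lam] \<and>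
     length (nats s ''i'') \<le> 1 \<and> length (nats s ''k'') \<le> 1"

definition signed :: "state \<Rightarrow> bool" where
  "signed s \<longleftrightarrow> (\<forall>a<n. read (reals s ''sign'') a = (if owner a then 1 else - 1))"

lemma slack_eq:
  assumes "env s" "signed s" "nats s ''i'' = [e]" "e < n * n"
  shows "reval slack_exp s = read (reals s ''y'') (e div n) + lam * read (reals s ''y'') (e mod n)
    - c (e div n) (e mod n)"
proof -
  have "read (reals s ''sign'') (e div n) = (if owner (e div n) then 1 else - 1)"
    using assms(2) pair_index(1)[OF assms(4)] unfolding signed_def by blast
  moreover have "read (reals s ''weight'') e = w (e div n * n + e mod n)"
    using assms(1,4) unfolding env_def pair_index(3)[OF assms(4)] by blast
  ultimately show ?thesis using assms(1,3) by (simp add: env_def c_eq)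
qed

abbreviation loop_time :: nat where "loop_time \<equiv> 200 * (n * n + 1)"

lemma init_correct:
  assumes "env s" "reals s ''value'' = []"
  shows "WP (6 + 4 * loop_time) init_com
    (\<lambda>s. env s \<and> signed s \<and> reals s ''value'' = [] \<and> feasible (read (reals s ''y'')) \<and> read (reals s ''q'') 0 = 1) s"
proof -
  define W where "W = 1 + (\<Sum>e<n * n. w e * w e)"
  have W: "w e \<le> W \<and> - w e \<le> W \<and> 1 \<le> W" if "e < n * n" for e
  proof -
    have "w e * w e \<le> (\<Sum>e<n * n. w e * w e)"
      by (rule member_le_sum) (use that in auto)
    moreover have "\<bar>w e\<bar> \<le> 1 + w e * w e"
      using zero_le_power2[of "\<bar>w e\<bar> - 1"] by (simp add: power2_eq_square algebra_simps) 
    moreover have "0 \<le> w e * w e" by simp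
    ultimately show ?thesis unfolding W_def by linarith
  qed
  have 1: "WP 3 (RWrite ''bound'' (NConst 0) ROne)
      (\<lambda>s. env s \<and> reals s ''value'' = [] \<and> read (reals s ''bound'') 0 = 1) s"
    by (rule wp_mono[OF wp_RWrite[where Q = "\<lambda>s. env s \<and> reals s ''value'' = [] \<and>
          read (reals s ''bound'') 0 = 1"]])
      (use assms in \<open>auto simp: env_def\<close>)
  have 2: "WP loop_time (For_Write ''i'' square_exp true_exp ''bound'' (NConst 0)
      (RAdd (RRead ''bound'' (NConst 0)) (RMul (RRead ''weight'' idx_exp) (RRead ''weight'' idx_exp))))
      (\<lambda>s. env s \<and> reals s ''value'' = [] \<and> read (reals s ''bound'') 0 = W) s1"
    if s1: "env s1 \<and> reals s1 ''value'' = [] \<and> read (reals s1 ''bound'') 0 = 1" for s1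
    by (rule wp_mono[OF wp_For_Write[where J = "\<lambda>k xs. read xs 0 = 1 + (\<Sum>e<k. w e * w e)" and N = "n * n"]])
      (use s1 in \<open>auto simp: env_def W_def\<close>)
  have 3: "WP loop_time (For_Write ''i'' size_exp true_exp ''sign'' idx_exp (RSub RZero ROne))
      (\<lambda>s. env s \<and> reals s ''value'' = [] \<and> read (reals s ''bound'') 0 = W
        \<and> (\<forall>a<n. read (reals s ''sign'') a = - 1)) s1"
    if s1: "env s1 \<and> reals s1 ''value'' = [] \<and> read (reals s1 ''bound'') 0 = W" for s1
    by (rule wp_mono[OF wp_For_Write_map[where g = "\<lambda>k. - 1" and N = n]])
      (use s1 in \<open>auto simp: loop_bound env_def\<close>)
  have 4: "WP loop_time (For_Write ''i'' size_exp (NEq (NRead ''owner'' idx_exp) (NConst 1)) ''sign'' idx_exp ROne)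
      (\<lambda>s. env s \<and> reals s ''value'' = [] \<and> read (reals s ''bound'') 0 = W \<and> signed s) s1"
    if s1: "env s1 \<and> reals s1 ''value'' = [] \<and> read (reals s1 ''bound'') 0 = W
      \<and> (\<forall>a<n. read (reals s1 ''sign'') a = - 1)" for s1
  proof (rule wp_mono[OF wp_For_Write[where N = n and
          J = "\<lambda>k xs. \<forall>a<n. read xs a = (if a < k \<and> owner a then 1 else - 1)"]])
    have test: "beval (NEq (NRead ''owner'' idx_exp) (NConst 1)) (upd s1 ''i'' k ''sign'' xs) \<longleftrightarrow> owner k"
      if "k < n" for k and xs :: "real list" using s1 that by (simp add: env_def)
    fix k and xs :: "real list"
    assume k: "k < n" and J: "\<forall>a<n. read xs a = (if a < k \<and> owner a then 1 else - 1)"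
    have less: "a < Suc k \<longleftrightarrow> a < k \<or> a = k" for a by (simp add: less_Suc_eq)
    show "neval idx_exp (upd s1 ''i'' k ''sign'' xs) < n * n + n + 1 \<and>
      (\<forall>a<n. read (write xs (neval idx_exp (upd s1 ''i'' k ''sign'' xs))
         (reval ROne (upd s1 ''i'' k ''sign'' xs))) a = (if a < Suc k \<and> owner a then 1 else - 1))"
      if "beval (NEq (NRead ''owner'' idx_exp) (NConst 1)) (upd s1 ''i'' k ''sign'' xs)"
      using that J k unfolding test[OF k] less by simp
    show "\<forall>a<n. read xs a = (if a < Suc k \<and> owner a then 1 else - 1)"
      if "\<not> beval (NEq (NRead ''owner'' idx_exp) (NConst 1)) (upd s1 ''i'' k ''sign'' xs)"
      using that J unfolding test[OF k] less by metis
  next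
    fix s' assume "\<exists>xs. s' = upd s1 ''i'' n ''sign'' xs \<and>
      (\<forall>a<n. read xs a = (if a < n \<and> owner a then 1 else - 1))"
    then show "env s' \<and> reals s' ''value'' = [] \<and> read (reals s' ''bound'') 0 = W \<and> signed s'"
      using s1 by (auto simp: env_def signed_def)
  qed (use s1 in \<open>simp_all add: loop_bound env_def\<close>)
  have 5: "WP loop_time (For_Write ''i'' size_exp true_exp ''y'' idx_exp (RRead ''bound'' (NConst 0)))
      (\<lambda>s. env s \<and> reals s ''value'' = [] \<and> signed s \<and> (\<forall>a<n. read (reals s ''y'') a = W)) s1"
    if s1: "env s1 \<and> reals s1 ''value'' = [] \<and> read (reals s1 ''bound'') 0 = W \<and> signed s1" for s1
    by (rule wp_mono[OF wp_For_Write_map[where g = "\<lambda>k. W" and N = n]])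
      (use s1 in \<open>auto simp: loop_bound env_def signed_def\<close>)
  have feas: "feasible y" if "\<forall>a<n. y a = W" for y
    unfolding feasible_def
  proof (intro allI impI)
    fix a b assume ab: "a < n" "b < n"
    have "c a b \<le> W" using W[OF pair_index_less[OF ab]] by (auto simp: c_eq)
    moreover have "0 \<le> lam * W" using lam W[OF pair_index_less[OF ab]] by simp
    ultimately show "c a b \<le> y a + lam * y b" using that ab by simp
  qed
  have 6: "WP 3 (RWrite ''q'' (NConst 0) ROne)
      (\<lambda>s. env s \<and> signed s \<and> reals s ''value'' = [] \<and> feasible (read (reals s ''y'')) \<and> read (reals s ''q'') 0 = 1) s1"
    if s1: "env s1 \<and> reals s1 ''value'' = [] \<and> signed s1 \<and> (\<forall>a<n. read (reals s1 ''y'') a = W)" for s1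
    by (rule wp_mono[OF wp_RWrite[where Q = "\<lambda>s. env s \<and> signed s \<and> reals s ''value'' = [] \<and>
          feasible (read (reals s ''y'')) \<and> read (reals s ''q'') 0 = 1"]])
      (use s1 feas in \<open>auto simp: env_def signed_def\<close>)
  have "WP (3 + (loop_time + (loop_time + (loop_time + (loop_time + 3))))) init_com
    (\<lambda>s. env s \<and> signed s \<and> reals s ''value'' = [] \<and> feasible (read (reals s ''y'')) \<and> read (reals s ''q'') 0 = 1) s"
    unfolding init_com_def
    by (rule wp_Seq, rule wp_mono[OF 1 order_refl], rule wp_Seq, rule wp_mono[OF 2 order_refl], assumption,
        rule wp_Seq, rule wp_mono[OF 3 order_refl], assumption,
        rule wp_Seq, rule wp_mono[OF 4 order_refl], assumption,
        rule wp_Seq, rule wp_mono[OF 5 order_refl], assumption, rule 6, assumption)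
  then show ?thesis by (rule wp_mono) auto
qed

lemma next_loop_correct:
  assumes s: "env s" "signed s" and init: "\<forall>a<n. read (reals s ''next'') a = - 1"
  defines "T \<equiv> tight (read (reals s ''y''))" and "d \<equiv> read (reals s ''dir'')"
  shows "WP loop_time (For_Write ''i'' square_exp
       (BAnd edge_exp (BAnd (REq slack_exp RZero) (RLess (RRead ''next'' row_exp) reply_exp)))
       ''next'' row_exp reply_exp)
    (\<lambda>s'. \<exists>xs. s' = upd s ''i'' (n * n) ''next'' xs \<and> (\<forall>a<n. read xs a = step T d a)) s"
proof -
  \<comment> \<open>For the pairs scanned so far these are the assumptions of
    \<open>step_eqI\<close>: the entry is at least \<open>-1\<close>, dominates the replies and is
    attained. At \<open>k = n * n\<close> it is therefore \<open>step T d a\<close>.\<close>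
  define J where "J k xs \<longleftrightarrow> (\<forall>a<n. - 1 \<le> read xs a \<and>
      (\<forall>e<k. e div n = a \<and> T a (e mod n) \<longrightarrow> - lam * d (e mod n) \<le> read xs a) \<and>
      (read xs a = - 1 \<or> (\<exists>e<k. e div n = a \<and> T a (e mod n) \<and> read xs a = - lam * d (e mod n))))" for k xs
  have test: "beval (BAnd edge_exp (BAnd (REq slack_exp RZero) (RLess (RRead ''next'' row_exp) reply_exp)))
        (upd s ''i'' k ''next'' xs) \<longleftrightarrow>
      T (k div n) (k mod n) \<and> read xs (k div n) < - lam * d (k mod n)"
    and reply: "reval reply_exp (upd s ''i'' k ''next'' xs) = - lam * d (k mod n)"
    and row: "neval row_exp (upd s ''i'' k ''next'' xs) = k div n"
    if "k < n * n" for k xs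
  proof -
    have e: "env (upd s ''i'' k ''next'' xs)" "signed (upd s ''i'' k ''next'' xs)"
      using s by (auto simp: env_def signed_def)
    show "reval reply_exp (upd s ''i'' k ''next'' xs) = - lam * d (k mod n)"
      and "neval row_exp (upd s ''i'' k ''next'' xs) = k div n"
      using s by (auto simp: env_def d_def)
    then show "beval (BAnd edge_exp (BAnd (REq slack_exp RZero) (RLess (RRead ''next'' row_exp) reply_exp)))
        (upd s ''i'' k ''next'' xs) \<longleftrightarrow>
      T (k div n) (k mod n) \<and> read xs (k div n) < - lam * d (k mod n)"
      using slack_eq[OF e _ that] that s
      unfolding beval.simps T_def tight_def
      by (auto simp del: reval.simps(4-) simp: env_def)
  qed
  show ?thesis
  proof (rule wp_mono[OF wp_For_Write[where J = J and N = "n * n"]])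
    show "J 0 (reals s ''next'')" using init by (simp add: J_def)
  next
    fix k xs assume k: "k < n * n" and J: "J k xs"
      and b: "beval (BAnd edge_exp (BAnd (REq slack_exp RZero) (RLess (RRead ''next'' row_exp) reply_exp)))
        (upd s ''i'' k ''next'' xs)"
    note b = b[unfolded test[OF k]]
    have "J (Suc k) (write xs (k div n) (- lam * d (k mod n)))"
      unfolding J_def
    proof (intro allI impI)
      fix a assume a: "a < n"
      have J': "- 1 \<le> read xs a" 
        "\<And>e. e < k \<Longrightarrow> e div n = a \<Longrightarrow> T a (e mod n) \<Longrightarrow> - lam * d (e mod n) \<le> read xs a"
        "read xs a = - 1 \<or> (\<exists>e<k. e div n = a \<and> T a (e mod n) \<and> read xs a = - lam * d (e mod n))"
        using J a unfolding J_def by blast+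
      show "- 1 \<le> read (write xs (k div n) (- lam * d (k mod n))) a \<and>
        (\<forall>e<Suc k. e div n = a \<and> T a (e mod n) \<longrightarrow>
           - lam * d (e mod n) \<le> read (write xs (k div n) (- lam * d (k mod n))) a) \<and>
        (read (write xs (k div n) (- lam * d (k mod n))) a = - 1 \<or>
         (\<exists>e<Suc k. e div n = a \<and> T a (e mod n) \<and>
            read (write xs (k div n) (- lam * d (k mod n))) a = - lam * d (e mod n)))"
      proof (cases "a = k div n")
        case True
        show ?thesis
          unfolding read_write if_P[OF True]
          using J'(1,2) b True by (fastforce simp: less_Suc_eq)
      next
        case False
        show ?thesis
          unfolding read_write if_not_P[OF False]
          using J' False by (auto simp: less_Suc_eq)
      qed
    qed
    then show "neval row_exp (upd s ''i'' k ''next'' xs) < n * n + n + 1 \<and>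
      J (Suc k) (write xs (neval row_exp (upd s ''i'' k ''next'' xs)) (reval reply_exp (upd s ''i'' k ''next'' xs)))"
      unfolding reply[OF k] row[OF k] using pair_index[OF k] by simp
  next
    fix k xs assume k: "k < n * n" and J: "J k xs"
      and b: "\<not> beval (BAnd edge_exp (BAnd (REq slack_exp RZero) (RLess (RRead ''next'' row_exp) reply_exp)))
        (upd s ''i'' k ''next'' xs)"
    note b = b[unfolded test[OF k]]
    then have b: "T (k div n) (k mod n) \<Longrightarrow> - lam * d (k mod n) \<le> read xs (k div n)" by linarith
    show "J (Suc k) xs" using J b unfolding J_def less_Suc_eq by blast
  next
    fix s' assume "\<exists>xs. s' = upd s ''i'' (n * n) ''next'' xs \<and> J (n * n) xs"
    then obtain xs where s': "s' = upd s ''i'' (n * n) ''next'' xs" and J: "J (n * n) xs" by blast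
    have "read xs a = step T d a" if a: "a < n" for a
    proof (rule step_eqI)
      show "- 1 \<le> read xs a" using J a by (simp add: J_def)
      show "- lam * d b \<le> read xs a" if b: "b < n" "T a b" for b
      proof -
        have "(a * n + b) div n = a" "(a * n + b) mod n = b" using b by auto
        then show ?thesis using J a b pair_index_less[OF a b(1)] unfolding J_def by metis
      qed
      show "read xs a = - 1 \<or> (\<exists>b<n. T a b \<and> read xs a = - lam * d b)"
        using J a pair_index(2) unfolding J_def by meson
    qed
    then show "\<exists>xs. s' = upd s ''i'' (n * n) ''next'' xs \<and> (\<forall>a<n. read xs a = step T d a)" using s' by blast
  qed (use s in \<open>auto simp: env_def\<close>)
qed

lemma round_correct:
  assumes s: "env s" "signed s"
  shows "WP (3 * loop_time) round_com
    (\<lambda>s'. env s' \<and> nats s' ''k'' = nats s ''k'' \<and> (\<forall>A. A \<notin> {''dir'', ''next''} \<longrightarrow> reals s' A = reals s A) \<and>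
      (\<forall>a<n. read (reals s' ''dir'') a = step (tight (read (reals s ''y''))) (read (reals s ''dir'')) a)) s"
    (is "WP _ _ ?Q s")
proof -
  have 1: "WP loop_time (For_Write ''i'' size_exp true_exp ''next'' idx_exp (RSub RZero ROne))
      (\<lambda>s'. \<exists>xs. s' = upd s ''i'' n ''next'' xs \<and> (\<forall>a<n. read xs a = - 1)) s"
    by (rule wp_mono[OF wp_For_Write_map[where g = "\<lambda>k. - 1" and N = n]])
      (use s in \<open>auto simp: loop_bound env_def\<close>)
  have 3: "WP loop_time (For_Write ''i'' size_exp true_exp ''dir'' idx_exp (RRead ''next'' idx_exp))
      (\<lambda>s'. \<exists>xs. s' = upd s1 ''i'' n ''dir'' xs \<and> (\<forall>a<n. read xs a = read (reals s1 ''next'') a)) s1"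
    if "env s1" for s1
    by (rule wp_mono[OF wp_For_Write_map[where g = "read (reals s1 ''next'')" and N = n]])
      (use that in \<open>auto simp: loop_bound env_def\<close>)
  have "WP (loop_time + (loop_time + loop_time)) round_com ?Q s"
    unfolding round_com_def
  proof (rule wp_Seq, rule wp_mono[OF 1 order_refl], elim exE conjE)
    fix s1 xs assume s1: "s1 = upd s ''i'' n ''next'' xs" "\<forall>a<n. read xs a = - 1"
    have e1: "env s1" "signed s1" "\<forall>a<n. read (reals s1 ''next'') a = - 1"
      using s s1 by (auto simp: env_def signed_def)
    show "WP (loop_time + loop_time) (Seq (For_Write ''i'' square_exp
           (BAnd edge_exp (BAnd (REq slack_exp RZero) (RLess (RRead ''next'' row_exp) reply_exp)))
           ''next'' row_exp reply_exp)
         (For_Write ''i'' size_exp true_exp ''dir'' idx_exp (RRead ''next'' idx_exp))) ?Q s1"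
    proof (rule wp_Seq, rule wp_mono[OF next_loop_correct[OF e1] order_refl], elim exE conjE)
      fix s2 ys
      assume s2: "s2 = upd s1 ''i'' (n * n) ''next'' ys"
        "\<forall>a<n. read ys a = step (tight (read (reals s1 ''y''))) (read (reals s1 ''dir'')) a"
      have e2: "env s2" using e1 s2 by (auto simp: env_def)
      show "WP loop_time (For_Write ''i'' size_exp true_exp ''dir'' idx_exp (RRead ''next'' idx_exp)) ?Q s2"
        by (rule wp_mono[OF 3[OF e2] order_refl]) (use s s1 s2 in \<open>auto simp: env_def\<close>)
    qed
  qed
  then show ?thesis by (rule wp_mono) auto
qed

abbreviation direction_time :: nat where
  "direction_time \<equiv> loop_time + (n * (12 + 3 * loop_time) + 9)"

text \<open>The initial zeros are \<open>iter ?T 0\<close> and each round applies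
  \<open>step\<close> once more, so \<open>n\<close> rounds produce \<open>val ?T\<close>.\<close>

lemma direction_correct:
  assumes s: "env s" "signed s"
  shows "WP direction_time direction_com
    (\<lambda>s'. env s' \<and> (\<forall>A. A \<notin> {''dir'', ''next''} \<longrightarrow> reals s' A = reals s A) \<and>
      (\<forall>a<n. read (reals s' ''dir'') a = val (tight (read (reals s ''y''))) a)) s"
    (is "WP _ _ ?Q s")
proof -
  let ?T = "tight (read (reals s ''y''))"
  have 1: "WP loop_time (For_Write ''i'' size_exp true_exp ''dir'' idx_exp RZero)
      (\<lambda>s'. \<exists>xs. s' = upd s ''i'' n ''dir'' xs \<and> (\<forall>a<n. read xs a = 0)) s"
    by (rule wp_mono[OF wp_For_Write_map[where g = "\<lambda>k. 0" and N = n]])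
      (use s in \<open>auto simp: loop_bound env_def\<close>)
  let ?I = "\<lambda>k s'. env s' \<and> nats s' ''k'' = [k] \<and> (\<forall>A. A \<notin> {''dir'', ''next''} \<longrightarrow> reals s' A = reals s A) \<and>
      (\<forall>a<n. read (reals s' ''dir'') a = iter ?T k a)"
  have 2: "WP (n * (10 + ncost size_exp + 3 * loop_time) + (7 + ncost size_exp)) (For ''k'' size_exp round_com) (?I n) s1"
    if s1: "s1 = upd s ''i'' n ''dir'' xs" "\<forall>a<n. read xs a = 0" for s1 xs
  proof (rule wp_For[where I = ?I])
    fix k s' assume I: "?I k s'"
    then have "signed s'" using s by (simp add: signed_def)
    \<comment> \<open>Rounds leave \<open>y\<close> alone, so all of them see the same tight
      edges.\<close>
    have y: "reals s' ''y'' = reals s ''y''" using I by simp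
    show "WP (3 * loop_time) round_com
      (\<lambda>s'. nats s' ''k'' = [k] \<and> ?I (Suc k) (s'\<lparr>nats := (nats s')(''k'' := [Suc k])\<rparr>)) s'"
    proof (rule wp_mono[OF round_correct order_refl])
      fix s'' assume s'': "env s'' \<and> nats s'' ''k'' = nats s' ''k'' \<and>
        (\<forall>A. A \<notin> {''dir'', ''next''} \<longrightarrow> reals s'' A = reals s' A) \<and>
        (\<forall>a<n. read (reals s'' ''dir'') a = step (tight (read (reals s' ''y''))) (read (reals s' ''dir'')) a)"
      have "step ?T (read (reals s' ''dir'')) a = iter ?T (Suc k) a" for a
        unfolding iter_Suc by (rule step_cong) (use I in auto)
      moreover have "env (s''\<lparr>nats := (nats s'')(''k'' := [Suc k])\<rparr>)"
        using conjunct1[OF s''] by (simp add: env_def)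
      ultimately show "nats s'' ''k'' = [k] \<and> ?I (Suc k) (s''\<lparr>nats := (nats s'')(''k'' := [Suc k])\<rparr>)"
        using s'' I y by simp
    qed (use I \<open>signed s'\<close> in auto)
  qed (use s s1 in \<open>auto simp: loop_bound env_def iter_0\<close>)
  have "WP (loop_time + (n * (10 + ncost size_exp + 3 * loop_time) + (7 + ncost size_exp))) direction_com ?Q s"
    unfolding direction_com_def
  proof (rule wp_Seq, rule wp_mono[OF 1 order_refl], elim exE conjE)
    fix s1 xs assume s1: "s1 = upd s ''i'' n ''dir'' xs" "\<forall>a<n. read xs a = 0"
    show "WP (n * (10 + ncost size_exp + 3 * loop_time) + (7 + ncost size_exp)) (For ''k'' size_exp round_com) ?Q s1"
      by (rule wp_mono[OF 2[OF s1] order_refl]) (auto simp: val_def)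
  qed
  then show ?thesis by (rule wp_mono) auto
qed

lemma q_loop_correct:
  assumes s: "env s" "signed s" and init: "read (reals s ''q'') 0 = 0"
  shows "WP loop_time (For_Write ''i'' square_exp (BAnd edge_exp (RLess (RRead ''q'' (NConst 0)) ratio_exp))
           ''q'' (NConst 0) ratio_exp)
    (\<lambda>s'. \<exists>xs. s' = upd s ''i'' (n * n) ''q'' xs \<and>
       inverse_step_length (read (reals s ''y'')) (read (reals s ''dir'')) (read xs 0)) s"
proof -
  let ?r = "\<lambda>e. ratio (read (reals s ''y'')) (read (reals s ''dir'')) (e div n) (e mod n)"
  let ?E = "\<lambda>e. E (e div n) (e mod n)"
  let ?b = "BAnd edge_exp (RLess (RRead ''q'' (NConst 0)) ratio_exp)"
  \<comment> \<open>The running maximum of 0 and the ratios of the edges scanned.\<close>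
  define J where "J k xs \<longleftrightarrow> 0 \<le> read xs 0 \<and> (\<forall>e<k. ?E e \<longrightarrow> ?r e \<le> read xs 0) \<and>
      (read xs 0 = 0 \<or> (\<exists>e<n * n. ?E e \<and> read xs 0 = ?r e))" for k :: nat and xs
  have r: "reval ratio_exp (upd s ''i'' k ''q'' xs) = ?r k"
    and b: "beval ?b (upd s ''i'' k ''q'' xs) \<longleftrightarrow> ?E k \<and> read xs 0 < ?r k"
    if "k < n * n" for k xs
  proof -
    have e: "env (upd s ''i'' k ''q'' xs)" "signed (upd s ''i'' k ''q'' xs)"
      using s by (auto simp: env_def signed_def)
    have sl: "reval slack_exp (upd s ''i'' k ''q'' xs) = read (reals s ''y'') (k div n)
      + lam * read (reals s ''y'') (k mod n) - c (k div n) (k mod n)"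
      using slack_eq[OF e _ that] by simp
    show r: "reval ratio_exp (upd s ''i'' k ''q'' xs) = ?r k"
      unfolding reval.simps(7) sl using s by (simp add: env_def ratio_def)
    show "beval ?b (upd s ''i'' k ''q'' xs) \<longleftrightarrow> ?E k \<and> read xs 0 < ?r k"
      unfolding beval.simps r using s that by (simp add: env_def)
  qed
  show ?thesis
  proof (rule wp_mono[OF wp_For_Write[where J = J and N = "n * n"]])
    fix k xs assume k: "k < n * n" and J: "J k xs" and bt: "beval ?b (upd s ''i'' k ''q'' xs)"
    have "?E k" "read xs 0 < ?r k" using bt b[OF k] by auto
    then have "J (Suc k) (write xs 0 (?r k))"
      using J k unfolding J_def less_Suc_eq by (auto intro: order_trans less_imp_le)
    then show "neval (NConst 0) (upd s ''i'' k ''q'' xs) < n * n + n + 1 \<and>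
      J (Suc k) (write xs (neval (NConst 0) (upd s ''i'' k ''q'' xs)) (reval ratio_exp (upd s ''i'' k ''q'' xs)))"
      unfolding r[OF k] by simp
  next
    fix k xs assume k: "k < n * n" and J: "J k xs" and bt: "\<not> beval ?b (upd s ''i'' k ''q'' xs)"
    have "?E k \<Longrightarrow> ?r k \<le> read xs 0" using bt b[OF k, of xs] by linarith
    then show "J (Suc k) xs" using J unfolding J_def less_Suc_eq by blast
  next
    fix s' assume "\<exists>xs. s' = upd s ''i'' (n * n) ''q'' xs \<and> J (n * n) xs"
    then obtain xs where s': "s' = upd s ''i'' (n * n) ''q'' xs" and J: "J (n * n) xs" by blast
    have "ratio (read (reals s ''y'')) (read (reals s ''dir'')) a b' \<le> read xs 0"
      if ab: "a < n" "b' < n" "E a b'" for a b'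
    proof -
      have "(a * n + b') div n = a" "(a * n + b') mod n = b'" using ab by auto
      then show ?thesis using J ab pair_index_less[OF ab(1,2)] unfolding J_def by metis
    qed
    moreover have "read xs 0 = 0 \<or> (\<exists>a<n. \<exists>b<n. E a b \<and>
        read xs 0 = ratio (read (reals s ''y'')) (read (reals s ''dir'')) a b)"
      using J pair_index(1,2) unfolding J_def by meson
    ultimately show "\<exists>xs. s' = upd s ''i'' (n * n) ''q'' xs \<and>
       inverse_step_length (read (reals s ''y'')) (read (reals s ''dir'')) (read xs 0)"
      using s' J unfolding inverse_step_length_def J_def by blast
  qed (use s init in \<open>auto simp: env_def J_def\<close>)
qed

text \<open>The last clause makes the exit from the loop correct: at \<open>q = 0\<close> the
  feasible \<open>y\<close> has a tight edge at every node and hence is a solution.\<close>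

definition invariant :: "state \<Rightarrow> bool" where
  "invariant s \<longleftrightarrow> env s \<and> signed s \<and> reals s ''value'' = [] \<and> feasible (read (reals s ''y'')) \<and>
     0 \<le> read (reals s ''q'') 0 \<and>
     (read (reals s ''q'') 0 = 0 \<longrightarrow> (\<forall>a<n. \<exists>b<n. tight (read (reals s ''y'')) a b))"

text \<open>\<open>Suc\<close> pays for the last pass, which finds \<open>q = 0\<close> and need not
  lower the rank. Ranks are below \<open>2 ^ n\<close>, so there are at most \<open>2 ^ n\<close>
  passes.\<close>

definition potential :: "state \<Rightarrow> nat" where
  "potential s = (if 0 < read (reals s ''q'') 0 then Suc (rank (tight (read (reals s ''y'')))) else 0)"

abbreviation move_time :: nat where
  "move_time \<equiv> direction_time + (3 + (loop_time + loop_time))"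

lemma move_correct:
  assumes inv: "invariant s" and pos: "0 < read (reals s ''q'') 0"
  shows "WP move_time move_com (\<lambda>s'. invariant s' \<and> potential s' < potential s) s"
    (is "WP _ _ ?Q s")
proof -
  have s: "env s" "signed s" "reals s ''value'' = []" "feasible (read (reals s ''y''))"
    using inv by (auto simp: invariant_def)
  let ?y = "read (reals s ''y'')"
  have fin: "WP loop_time (For_Write ''i'' size_exp true_exp ''y'' idx_exp
        (RAdd (RRead ''y'' idx_exp) (RDiv (RRead ''dir'' idx_exp) (RRead ''q'' (NConst 0))))) ?Q s1"
    if e: "env s1" "signed s1" "reals s1 ''value'' = []" "reals s1 ''y'' = reals s ''y''"
      and d: "\<And>a. a < n \<Longrightarrow> read (reals s1 ''dir'') a = val (tight ?y) a"
      and q: "inverse_step_length ?y (read (reals s1 ''dir'')) (read (reals s1 ''q'') 0)" for s1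
  proof (rule wp_mono[OF wp_For_Write_map[where N = n and
          g = "\<lambda>k. ?y k + read (reals s1 ''dir'') k / read (reals s1 ''q'') 0"]])
    fix s' assume "\<exists>xs. s' = upd s1 ''i'' n ''y'' xs \<and>
        (\<forall>k<n. read xs k = ?y k + read (reals s1 ''dir'') k / read (reals s1 ''q'') 0) \<and>
        length xs = max (length (reals s1 ''y'')) n"
    then obtain xs where s': "s' = upd s1 ''i'' n ''y'' xs"
      and xs: "\<And>k. k < n \<Longrightarrow> read xs k = ?y k + read (reals s1 ''dir'') k / read (reals s1 ''q'') 0" by blast
    have f: "feasible (read xs)" using feasible_move[OF s(4) d q xs] by simp
    have q0: "0 \<le> read (reals s1 ''q'') 0" using q by (simp add: inverse_step_length_def)
    have "\<forall>a<n. \<exists>b<n. tight (read xs) a b" if "read (reals s1 ''q'') 0 = 0"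
    proof (intro allI impI)
      fix a assume a: "a < n"
      obtain b where "b < n" "tight ?y a b" using no_move_imp_tight[OF s(4) d _ a] q \<open>read (reals s1 ''q'') 0 = 0\<close> by auto
      \<comment> \<open>As \<open>x / 0 = 0\<close>, the new point agrees with the old one on all
        nodes.\<close>
      then have "b < n \<and> tight (read xs) a b" using xs a that by (simp add: tight_def)
      then show "\<exists>b<n. tight (read xs) a b" by blast
    qed
    then have "invariant s'" using e s' f q0 by (auto simp: invariant_def env_def signed_def)
    moreover have "potential s' < potential s"
      using rank_move[OF s(4) d q xs] pos s' by (simp add: potential_def)
    ultimately show "?Q s'" by simp
  qed (use e in \<open>auto simp: loop_bound env_def\<close>)
  show ?thesis
    unfolding move_com_def
  proof (rule wp_Seq, rule wp_mono[OF direction_correct[OF s(1,2)] order_refl])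
    fix s1 assume s1: "env s1 \<and> (\<forall>A. A \<notin> {''dir'', ''next''} \<longrightarrow> reals s1 A = reals s A) \<and>
      (\<forall>a<n. read (reals s1 ''dir'') a = val (tight ?y) a)"
    let ?s2 = "s1\<lparr>reals := (reals s1)(''q'' := write (reals s1 ''q'') 0 0)\<rparr>"
    have 2: "env ?s2" "signed ?s2" "read (reals ?s2 ''q'') 0 = 0" "reals ?s2 ''value'' = []"
      "reals ?s2 ''y'' = reals s ''y''" "\<forall>a<n. read (reals ?s2 ''dir'') a = val (tight ?y) a"
      using s s1 by (auto simp: env_def signed_def)
    have "WP (loop_time + loop_time)
      (Seq (For_Write ''i'' square_exp (BAnd edge_exp (RLess (RRead ''q'' (NConst 0)) ratio_exp))
           ''q'' (NConst 0) ratio_exp)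
         (For_Write ''i'' size_exp true_exp ''y'' idx_exp
           (RAdd (RRead ''y'' idx_exp) (RDiv (RRead ''dir'' idx_exp) (RRead ''q'' (NConst 0)))))) ?Q ?s2"
    proof (rule wp_Seq, rule wp_mono[OF q_loop_correct[OF 2(1-3)] order_refl], elim exE conjE)
      fix s3 xs assume s3: "s3 = upd ?s2 ''i'' (n * n) ''q'' xs"
        "inverse_step_length (read (reals ?s2 ''y'')) (read (reals ?s2 ''dir'')) (read xs 0)"
      show "WP loop_time (For_Write ''i'' size_exp true_exp ''y'' idx_exp
           (RAdd (RRead ''y'' idx_exp) (RDiv (RRead ''dir'' idx_exp) (RRead ''q'' (NConst 0))))) ?Q s3"
        by (rule fin) (use 2 s3 in \<open>auto simp: env_def signed_def\<close>)
    qed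
    note tail = this
    have "WP ((1 + ncost (NConst 0) + rcost RZero) + (loop_time + loop_time))
      (Seq (RWrite ''q'' (NConst 0) RZero)
      (Seq (For_Write ''i'' square_exp (BAnd edge_exp (RLess (RRead ''q'' (NConst 0)) ratio_exp))
           ''q'' (NConst 0) ratio_exp)
         (For_Write ''i'' size_exp true_exp ''y'' idx_exp
           (RAdd (RRead ''y'' idx_exp) (RDiv (RRead ''dir'' idx_exp) (RRead ''q'' (NConst 0))))))) ?Q s1"
      by (rule wp_Seq, rule wp_RWrite) (use tail in simp_all)
    then show "WP (3 + (loop_time + loop_time))
      (Seq (RWrite ''q'' (NConst 0) RZero)
      (Seq (For_Write ''i'' square_exp (BAnd edge_exp (RLess (RRead ''q'' (NConst 0)) ratio_exp))
           ''q'' (NConst 0) ratio_exp)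
         (For_Write ''i'' size_exp true_exp ''y'' idx_exp
           (RAdd (RRead ''y'' idx_exp) (RDiv (RRead ''dir'' idx_exp) (RRead ''q'' (NConst 0))))))) ?Q s1"
      by (rule wp_mono) simp_all
  qed
qed

abbreviation solve_time :: nat where
  "solve_time \<equiv> 6 + 4 * loop_time + (2 ^ n * (5 + move_time) + 5 + loop_time)"

lemma solve_correct:
  assumes "env s" "reals s ''value'' = []"
  shows "WP solve_time solve_com
    (\<lambda>s'. \<exists>y. feasible y \<and> (\<forall>a<n. \<exists>b<n. tight y a b) \<and>
       reals s' ''value'' = map (\<lambda>a. (if owner a then 1 else - 1) * y a) [0..<n]) s"
    (is "WP _ _ ?Q s")
proof -
  let ?b = "RLess RZero (RRead ''q'' (NConst 0))"
  have out: "WP loop_time (For_Write ''i'' size_exp true_exp ''value'' idx_exp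
      (RMul (RRead ''sign'' idx_exp) (RRead ''y'' idx_exp))) ?Q s1"
    if inv: "invariant s1" and "\<not> beval ?b s1" for s1
  proof (rule wp_mono[OF wp_For_Write_map[where N = n and
          g = "\<lambda>a. (if owner a then 1 else - 1) * read (reals s1 ''y'') a"]])
    fix s' assume "\<exists>xs. s' = upd s1 ''i'' n ''value'' xs \<and>
      (\<forall>k<n. read xs k = (if owner k then 1 else - 1) * read (reals s1 ''y'') k) \<and>
      length xs = max (length (reals s1 ''value'')) n"
    then obtain xs where s': "s' = upd s1 ''i'' n ''value'' xs"
      and xs: "\<forall>k<n. read xs k = (if owner k then 1 else - 1) * read (reals s1 ''y'') k"
      and len: "length xs = n" using inv by (auto simp: invariant_def)
    \<comment> \<open>The output array was empty before the loop, so it has exactly \<open>n\<close>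
      entries.\<close>
    have "xs = map (\<lambda>a. (if owner a then 1 else - 1) * read (reals s1 ''y'') a) [0..<n]"
      by (rule nth_equalityI) (use xs len in \<open>auto simp: read_def\<close>)
    then show "?Q s'" using that s' by (intro exI[of _ "read (reals s1 ''y'')"]) (auto simp: invariant_def)
  qed (use inv in \<open>auto simp: loop_bound env_def signed_def invariant_def\<close>)
  have loop: "WP (2 ^ n * (1 + bcost ?b + move_time) + (1 + bcost ?b)) (While ?b move_com)
      (\<lambda>s'. invariant s' \<and> \<not> beval ?b s') s1"
    if s1: "env s1 \<and> signed s1 \<and> reals s1 ''value'' = [] \<and> feasible (read (reals s1 ''y'')) \<and>
      read (reals s1 ''q'') 0 = 1" for s1
  proof (rule wp_While[where f = potential])
    show "invariant s1" using s1 by (simp add: invariant_def)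
    show "potential s1 \<le> 2 ^ n"
      using s1 rank_less[of "tight (read (reals s1 ''y''))"] by (simp add: potential_def)
    show "WP move_time move_com (\<lambda>s'. invariant s' \<and> potential s' < potential s) s"
      if "invariant s" "beval ?b s" for s
      using that by (intro move_correct) simp_all
  qed simp
  have "WP (6 + 4 * loop_time + ((2 ^ n * (1 + bcost ?b + move_time) + (1 + bcost ?b)) + loop_time)) solve_com ?Q s"
    unfolding solve_com_def
    by (intro wp_Seq wp_mono[OF init_correct[OF assms] order_refl] wp_mono[OF loop order_refl] out) blast+
  then show ?thesis by (rule wp_mono) simp_all
qed

end

text \<open>Feasibility makes \<open>x v\<close> an upper bound of the options at a node of Max and
  a lower bound at a node of Min; a tight edge shows that it is attained. So \<open>x\<close> solves
  the optimality equations, and uniqueness identifies it with the values.\<close>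

lemma solve_com_finds_values:
  fixes \<Gamma> :: "'v game"
  assumes game: "discounted_game \<Gamma>" and bip: "bipartite \<Gamma>" and dist: "distinct vs" and vs: "set vs = nodes \<Gamma>"
  defines "n \<equiv> length vs"
  shows "\<exists>t m. finds_values solve_com \<Gamma> vs t m \<and> t \<le> 3000 * ((n + 1) ^ 3 * 2 ^ n) \<and>
    m \<le> space_bound names (n * n + n + 1)"
proof -
  interpret G: pair_fin_digraph "graph \<Gamma>" using game by (simp add: discounted_game_def)
  define lam where "lam = discount \<Gamma>"
  define E where "E a b \<longleftrightarrow> (vs ! a, vs ! b) \<in> edges \<Gamma>" for a b
  define w where "w e = (if E (e div n) (e mod n) then weight \<Gamma> (vs ! (e div n), vs ! (e mod n)) else 0)" for e
  define owner where "owner a \<longleftrightarrow> vs ! a \<in> max_nodes \<Gamma>" for a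
  define sg :: "nat \<Rightarrow> real" where "sg a = (if owner a then 1 else - 1)" for a
  define c where "c a b = sg a * w (a * n + b)" for a b
  have parts: "max_nodes \<Gamma> \<union> min_nodes \<Gamma> = nodes \<Gamma>" "max_nodes \<Gamma> \<inter> min_nodes \<Gamma> = {}"
    using game by (auto simp: discounted_game_def)
  have node: "vs ! a \<in> nodes \<Gamma>" if "a < n" for a
    using nth_mem[of a vs] that unfolding n_def vs .
  have succ: "\<exists>b'<n. b = vs ! b' \<and> E a b'" if "(vs ! a, b) \<in> edges \<Gamma>" for a b
  proof -
    have "b \<in> set vs" unfolding vs by (rule G.in_arcsD2[OF that])
    then show ?thesis using that by (auto simp: in_set_conv_nth n_def E_def)
  qed
  interpret encoded_game n lam E c w owner
  proof
    show "0 < lam" "lam < 1" using game by (auto simp: lam_def discounted_game_def)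
    show "\<exists>b<n. E a b" if a: "a < n" for a
    proof -
      obtain b where "(vs ! a, b) \<in> edges \<Gamma>" using game node[OF a] unfolding discounted_game_def by blast
      then show ?thesis using succ by blast
    qed
    show "c a b = (if owner a then 1 else - 1) * w (a * n + b)" for a b by (simp add: c_def sg_def)
  qed
  let ?s = "encode \<Gamma> vs"
  have len: "length (List.product vs vs) = n * n" by (simp add: n_def)
  have prod: "List.product vs vs ! e = (vs ! (e div n), vs ! (e mod n))" if "e < n * n" for e
    using product_nth[of e vs vs] that by (simp add: n_def)
  have env: "env ?s" "reals ?s ''value'' = []"
    unfolding env_def using prod len
    by (auto simp: encode_def read_def n_def[symmetric] owner_def w_def E_def lam_def)
  have small: "small names (n * n + n + 1) ?s"
    using len by (auto simp: small_def encode_def names_def n_def[symmetric])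
  obtain t m s' y where run: "exec solve_com ?s t m s'" "t \<le> solve_time" "m \<le> space_bound names (n * n + n + 1)"
    and y: "feasible y" "\<And>a. a < n \<Longrightarrow> \<exists>b<n. tight y a b"
    and val: "reals s' ''value'' = map (\<lambda>a. (if owner a then 1 else - 1) * y a) [0..<n]"
    using solve_correct[OF env] small unfolding wp_def by blast
  \<comment> \<open>Undoes the numbering of the nodes and the negation at those of Min.\<close>
  define x where "x v = (let a = inv_into {..<n} ((!) vs) v in sg a * y a)" for v
  have inj: "inj_on ((!) vs) {..<n}" using dist by (auto simp: n_def inj_on_def nth_eq_iff_index_eq)
  have x: "x (vs ! a) = sg a * y a" if "a < n" for a
    using inv_into_f_f[OF inj, of a] that by (simp add: x_def)
  have c_edge: "c a b = sg a * weight \<Gamma> (vs ! a, vs ! b)" if "a < n" "b < n" "E a b" for a b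
  proof -
    have "(a * n + b) div n = a" "(a * n + b) mod n = b" using that by auto
    then show ?thesis using that by (simp add: c_def w_def)
  qed
  \<comment> \<open>Bipartiteness enters here: the ends of an edge have different owners.\<close>
  have opp: "sg b = - sg a" if "E a b" for a b
    using bip that parts by (auto simp: sg_def owner_def E_def bipartite_def)
  have term_eq: "weight \<Gamma> (vs ! a, vs ! b) + lam * x (vs ! b) = sg a * (c a b - lam * y b)"
    if "a < n" "b < n" "E a b" for a b
    using x[OF that(2)] opp[OF that(3)] c_edge[OF that] by (cases "owner a") (simp_all add: sg_def algebra_simps)
  have opt: "optimality_equations \<Gamma> x"
    unfolding optimality_equations_iff[OF game]
  proof
    fix v assume "v \<in> nodes \<Gamma>"
    then obtain a where a: "a < n" "v = vs ! a" unfolding vs[symmetric] in_set_conv_nth n_def by blast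
    let ?S = "(\<lambda>b. weight \<Gamma> (v, b) + discount \<Gamma> * x b) ` (edges \<Gamma> `` {v})"
    have "edges \<Gamma> `` {v} \<subseteq> nodes \<Gamma>" by (auto dest: G.in_arcsD2)
    then have fin: "finite ?S" using finite_subset G.pair_finite_verts by blast
    have S: "\<exists>b<n. E a b \<and> z = sg a * (c a b - lam * y b)" if z: "z \<in> ?S" for z
    proof -
      obtain v' where v': "(vs ! a, v') \<in> edges \<Gamma>" "z = weight \<Gamma> (vs ! a, v') + lam * x v'"
        using z unfolding a(2) lam_def by blast
      then show ?thesis using succ[OF v'(1)] term_eq[OF a(1)] by metis
    qed
    obtain b where b: "b < n" "E a b" "y a = c a b - lam * y b"
      using y(2)[OF a(1)] by (force simp: tight_def)
    have "x v = weight \<Gamma> (v, vs ! b) + discount \<Gamma> * x (vs ! b)"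
      using term_eq[OF a(1) b(1,2)] x[OF a(1)] b(3) unfolding a(2) lam_def by simp
    then have mem: "x v \<in> ?S" using b(2) unfolding E_def a(2) by blast
    have le: "c a b - lam * y b \<le> y a" if "b < n" "E a b" for b
      using y(1) a that by (force simp: feasible_def)
    show "x v = optimality_operator \<Gamma> x v"
    proof (cases "v \<in> max_nodes \<Gamma>")
      case True
      then have "sg a = 1" using a by (simp add: sg_def owner_def)
      have "z \<le> x v" if z: "z \<in> ?S" for z
      proof -
        obtain b where "b < n" "E a b" "z = sg a * (c a b - lam * y b)" using S[OF z] by blast
        then show ?thesis using le[of b] x[OF a(1)] a(2) \<open>sg a = 1\<close> by simp
      qed
      then have "Max ?S = x v" by (rule Max_eqI[OF fin _ mem])
      then show ?thesis using True by (simp add: optimality_operator_def)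
    next
      case False
      then have "sg a = - 1" using a by (simp add: sg_def owner_def)
      have "x v \<le> z" if z: "z \<in> ?S" for z
      proof -
        obtain b where "b < n" "E a b" "z = sg a * (c a b - lam * y b)" using S[OF z] by blast
        then show ?thesis using le[of b] x[OF a(1)] a(2) \<open>sg a = - 1\<close> by simp
      qed
      then have "Min ?S = x v" by (rule Min_eqI[OF fin _ mem])
      then show ?thesis using False by (simp add: optimality_operator_def)
    qed
  qed
  have "game_values \<Gamma> (vs ! a) = sg a * y a" if "a < n" for a
    using optimality_equations_unique[OF game game_values_optimality_equations[OF game] opt node[OF that]] x[OF that]
    by simp
  then have "reals s' ''value'' = map (game_values \<Gamma>) vs"
    unfolding val by (intro nth_equalityI) (auto simp: n_def sg_def)
  moreover have "t \<le> 3000 * ((n + 1) ^ 3 * 2 ^ n)"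
  proof -
    \<comment> \<open>\<open>n * loop_time\<close> is \<open>200 * (n ^ 3 + n)\<close>, so a
      multiple of \<open>u\<close> absorbs the cost of a move. With \<open>p * u\<close> as an atom
      the estimate becomes linear.\<close>
    define u where "u = (n + 1) ^ 3"
    define p :: nat where "p = 2 ^ n"
    define l where "l = loop_time"
    have "u = n * n * n + 3 * (n * n) + 3 * n + 1" by (simp add: u_def power3_eq_cube algebra_simps)
    then have u: "l \<le> 200 * u" "n * l \<le> 200 * u" "n \<le> u" "1 \<le> u"
      by (auto simp: l_def algebra_simps)
    have "5 + (l + (n * (12 + 3 * l) + 9) + (3 + (l + l))) \<le> 1300 * u"
      using u by (simp add: algebra_simps)
    then have "p * (5 + (l + (n * (12 + 3 * l) + 9) + (3 + (l + l)))) \<le> p * (1300 * u)"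
      by (rule mult_le_mono2)
    moreover have "u \<le> p * u" by (simp add: p_def)
    moreover have "p * (1300 * u) = 1300 * (p * u)" by simp
    ultimately have "6 + 4 * l + (p * (5 + (l + (n * (12 + 3 * l) + 9) + (3 + (l + l)))) + 5 + l) \<le> 3000 * (p * u)"
      using u by linarith
    then show ?thesis using run(2) by (simp add: l_def p_def u_def mult.commute)
  qed
  ultimately show ?thesis using run unfolding finds_values_def by blast
qed

theorem theorem2:
  shows "\<exists>(P :: com) (T :: nat \<Rightarrow> nat) (S :: nat \<Rightarrow> nat) (j :: nat) (k :: nat).
    (\<lambda>n. real (T n)) \<in> O(\<lambda>n. real n ^ j * 2 ^ n) \<and>
    (\<lambda>n. real (S n)) \<in> O(\<lambda>n. real n ^ k) \<and>
    (\<forall>(\<Gamma> :: nat game) vs.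
       discounted_game \<Gamma> \<longrightarrow> bipartite \<Gamma> \<longrightarrow> distinct vs \<longrightarrow> set vs = nodes \<Gamma> \<longrightarrow>
       (\<exists>t m. finds_values P \<Gamma> vs t m \<and>
          t \<le> T (card (nodes \<Gamma>)) \<and> m \<le> S (card (nodes \<Gamma>))))"
proof -
  let ?T = "\<lambda>n. 3000 * ((n + 1) ^ 3 * 2 ^ n) :: nat" and ?S = "\<lambda>n. space_bound names (n * n + n + 1)"
  \<comment> \<open>Each of the at most \<open>2 ^ n\<close> moves makes \<open>n\<close> rounds
    over \<open>n * n\<close> pairs, whence the exponent 3.\<close>
  have "(\<lambda>n. real (?T n)) \<in> O(\<lambda>n. real n ^ 3 * 2 ^ n)"
    unfolding of_nat_mult of_nat_power of_nat_add of_nat_numeral of_nat_1 by real_asymp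
  \<comment> \<open>The exponent 4 comes from arrays of quadratic length whose naturals are charged
    by their size instead of their number of digits.\<close>
  moreover have "(\<lambda>n. real (?S n)) \<in> O(\<lambda>n. real n ^ 4)"
    unfolding space_bound_def card_names of_nat_mult of_nat_power of_nat_add of_nat_numeral of_nat_1
    by real_asymp
  moreover have "\<exists>t m. finds_values solve_com \<Gamma> vs t m \<and> t \<le> ?T (card (nodes \<Gamma>)) \<and> m \<le> ?S (card (nodes \<Gamma>))"
    if "discounted_game \<Gamma>" "bipartite \<Gamma>" "distinct vs" "set vs = nodes \<Gamma>" for \<Gamma> :: "nat game" and vs
    using solve_com_finds_values[OF that] distinct_card[OF that(3)] that(4) by simp
  ultimately show ?thesis
    by (intro exI[of _ solve_com] exI[of _ ?T] exI[of _ ?S] exI[of _ 3] exI[of _ 4]) simp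
qed

end
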